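(* (i) For every integer $d$ with $1\leq d\leq 13$, the $f^*$-vector of every $d$-dimensional lattice polytope $P\subset\mathbb{R}^d$ is unimodal. (ii) There exists a $15$-dimensional lattice simplex whose $f^*$-vector is not unimodal.
   Context: A lattice polytope is the convex hull of finitely many points of $\mathbb{Z}^d$; a lattice simplex is a lattice polytope that is a simplex. For a $d$-dimensional lattice polytope $P\subset\mathbb{R}^d$ and a positive integer $n$, let $\operatorname{ehr}_P(n)=|nP\cap\mathbb{Z}^d|$ (a polynomial in $n$ of degree $d$). The $f^*$-vector $(f^*_0,\dots,f^*_d)$ of $P$ is defined by $\operatorname{ehr}_P(n)=\sum_{k=0}^d f^*_k\binom{n-1}{k}$ for all positive integers $n$. A sequence $(a_0,\dots,a_d)$ is unimodal if there is an index $p$ with $a_0\leq a_1\leq\cdots\leq a_p\geq a_{p+1}\geq\cdots\geq a_d$. *)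

theory Defs
  imports "HOL-Analysis.Analysis"
begin

definition integer_points :: "(real ^ 'n) set" where
  "integer_points = {x. \<forall>i. x $ i \<in> \<int>}"

definition lattice_polytope :: "(real ^ 'n) set \<Rightarrow> bool" where
  "lattice_polytope P \<longleftrightarrow> (\<exists>S. finite S \<and> S \<subseteq> integer_points \<and> P = convex hull S)"

definition ehr :: "(real ^ 'n) set \<Rightarrow> nat \<Rightarrow> nat" where
  "ehr P n = card ((\<lambda>x. real n *\<^sub>R x) ` P \<inter> integer_points)"

definition is_fstar_vector :: "(real ^ 'n) set \<Rightarrow> real list \<Rightarrow> bool" where
  "is_fstar_vector P v \<longleftrightarrow> length v = CARD('n) + 1 \<and>
     (\<forall>n>0. real (ehr P n) = (\<Sum>k\<le>CARD('n). v ! k * real ((n - 1) choose k)))"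

text \<open>
  For a full-dimensional lattice polytope such a vector exists by Ehrhart's theorem;
  uniqueness holds for every set and is shown below.
\<close>

definition fstar_vector :: "(real ^ 'n) set \<Rightarrow> real list" where
  "fstar_vector P = (THE v. is_fstar_vector P v)"

definition unimodal :: "real list \<Rightarrow> bool" where
  "unimodal a \<longleftrightarrow> (\<exists>p < length a.
     (\<forall>i < p. a ! i \<le> a ! Suc i) \<and>
     (\<forall>i \<ge> p. Suc i < length a \<longrightarrow> a ! i \<ge> a ! Suc i))"

lemma is_fstar_vector_unique:
  fixes P :: "(real ^ 'n) set"
  assumes v: "is_fstar_vector P v" and w: "is_fstar_vector P w"
  shows "v = w"
proof (rule nth_equalityI)
  show "length v = length w"
    using v w by (simp add: is_fstar_vector_def)
next
  fix k assume "k < length v"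
  then have "k \<le> CARD('n)"
    using v by (simp add: is_fstar_vector_def)
  then show "v ! k = w ! k"
  proof (induction k rule: less_induct)
    case (less k)
    have split: "(\<Sum>j\<le>CARD('n). u ! j * real (k choose j)) = (\<Sum>j<k. u ! j * real (k choose j)) + u ! k"
      for u :: "real list"
    proof -
      have "(\<Sum>j\<le>CARD('n). u ! j * real (k choose j)) = (\<Sum>j\<le>k. u ! j * real (k choose j))"
        using less.prems by (intro sum.mono_neutral_right) auto
      then show ?thesis
        by (simp add: lessThan_Suc_atMost [symmetric])
    qed
    have "(\<Sum>j\<le>CARD('n). v ! j * real (k choose j)) = (\<Sum>j\<le>CARD('n). w ! j * real (k choose j))"
      using v w unfolding is_fstar_vector_def by (metis diff_Suc_1 zero_less_Suc)
    moreover have "(\<Sum>j<k. v ! j * real (k choose j)) = (\<Sum>j<k. w ! j * real (k choose j))"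
      using less by (intro sum.cong) auto
    ultimately show ?case
      by (simp add: split)
  qed
qed

lemma fstar_vector_eqI: "is_fstar_vector P v \<Longrightarrow> fstar_vector P = v"
  unfolding fstar_vector_def by (blast intro: is_fstar_vector_unique)

end

theory Submission
  imports Defs "HOL-Computational_Algebra.Polynomial"
begin

text \<open>
  Generic weights on the vertices of \<open>P\<close> induce a regular triangulation, and moving every point slightly
  in a generic direction \<open>q\<close> splits the cone over \<open>P\<close> into half-open simplicial cones. Counting the
  lattice points of their fundamental boxes gives \<open>ehr P n = (\<Sum>k. h k * ((n + d - k) choose d))\<close> with
  \<open>h k \<ge> 0\<close> and \<open>h 0 = 1\<close>. Using the direction \<open>- q\<close> instead counts the interior points and reverses
  \<open>h\<close>. The boundary of \<open>P\<close>, viewed from an interior point, is a complete fan; the same argument gives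
  its Ehrhart function non-negative coefficients \<open>a k\<close>, and comparison with
  \<open>P\<close> minus its interior yields \<open>a k = (\<Sum>j\<le>k. h j - h (d + 1 - j))\<close>. As \<open>a\<close> does not depend on the
  direction, choosing one with exactly \<open>k\<close> negative coordinates at some simplex shows \<open>a k \<ge> 1\<close>. These
  inequalities force unimodality of \<open>f\<^sup>*\<close> up to dimension 13 by linear programming duality.

  In dimension 15 a simplex of Reeve type has \<open>h\<close>-polynomial \<open>1 + 200 t^8\<close>, and its \<open>f\<^sup>*\<close>-vector contains
  the valley \<open>13070 > 13040 < 13608\<close>.
\<close>

section \<open>Half-open decompositions of cones\<close>

text \<open>No triangulation is built as a geometric complex. The counts need only that each point
  \<open>x\<close> lies in exactly one half-open cone, and this is linear programming: for small
  \<open>t > 0\<close>, minimise the total weight among all ways to write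
  \<open>x + t *\<^sub>R q\<close> as a non-negative combination of \<open>S\<close>. An optimal
  basis exists and is regular, and duality makes it unique; generic weights exclude ties, a generic
  \<open>q\<close> excludes degenerate bases. The interior point \<open>c\<close> from which the
  boundary is viewed is in general not a lattice point, so the generators \<open>s - c\<close> of
  the fan need not be integral. Points are therefore recorded by barycentric weights on the vertices
  of \<open>P\<close>; in this form one count serves the cone over \<open>P\<close>, the fan and the
  simplex in dimension 15. That \<open>a\<close> does not depend on the direction is not automatic:
  its entries multiply \<open>d + 1\<close> polynomials in \<open>n\<close> of degree
  \<open>d - 1\<close>, which are linearly dependent. The extra equation \<open>a 0 = 1\<close>,
  which comes from the single cone containing the origin, makes them unique.\<close>

definition basis :: "'v::euclidean_space set \<Rightarrow> bool" where
  "basis B \<longleftrightarrow> independent B \<and> span B = UNIV"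

lemma basis_finite: "basis B \<Longrightarrow> finite B"
  by (simp add: basis_def independent_imp_finite)

lemma basis_card: "basis B \<Longrightarrow> card B = DIM('v)" for B :: "'v::euclidean_space set"
  unfolding basis_def by (metis dim_UNIV dim_eq_card_independent dim_span)

lemma sum_representation:
  "basis B \<Longrightarrow> (\<Sum>b\<in>B. representation B x b *\<^sub>R b) = x"
  by (simp add: basis_def basis_finite real_vector.sum_representation_eq independent_imp_finite)

lemma representation_unique:
  assumes "basis B" "b \<in> B"
  shows "representation B (\<Sum>b\<in>B. c b *\<^sub>R b) b = c b"
proof -
  have fin: "finite B" using assms by (simp add: basis_finite)
  have "representation B (\<Sum>b\<in>B. c b *\<^sub>R b) = (\<lambda>b. \<Sum>x\<in>B. representation B (c x *\<^sub>R x) b)"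
    using assms by (subst real_vector.representation_sum) (auto simp: basis_def)
  then have "representation B (\<Sum>b\<in>B. c b *\<^sub>R b) b = (\<Sum>x\<in>B. c x * representation B x b)"
    using assms by (simp add: basis_def real_vector.representation_scale)
  also have "\<dots> = (\<Sum>x\<in>B. if x = b then c x else 0)"
    using assms by (intro sum.cong) (auto simp: basis_def real_vector.representation_basis)
  finally show ?thesis using fin assms by simp
qed

lemma representation_line:
  "basis B \<Longrightarrow> representation B (x + t *\<^sub>R q) b = representation B x b + t * representation B q b"
  by (simp add: basis_def real_vector.representation_add real_vector.representation_scale)

lemma representation_sum_scale:
  assumes "basis B"
  shows "representation B (\<Sum>i\<in>I. c i *\<^sub>R v i) b = (\<Sum>i\<in>I. c i * representation B (v i) b)"
  using assms by (simp add: basis_def real_vector.representation_sum real_vector.representation_scale)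

lemma representation_uminus:
  "basis B \<Longrightarrow> representation B (- x) b = - representation B x b"
  by (simp add: basis_def real_vector.representation_neg)

section \<open>The ratio test and Caratheodory's theorem for cones\<close>

lemma ratio_min:
  fixes l u :: "'a \<Rightarrow> real"
  assumes "finite A" "a \<in> A" "u a > 0" "\<forall>b\<in>A. 0 \<le> l b"
  obtains t c where "c \<in> A" "u c > 0" "t * u c = l c" "0 \<le> t" "\<forall>b\<in>A. t * u b \<le> l b"
proof -
  let ?A = "{b\<in>A. u b > 0}"
  have "finite ?A" "?A \<noteq> {}" using assms by auto
  from arg_min_if_finite[OF this, of "\<lambda>b. l b / u b"]
  obtain c where c: "c \<in> ?A" "\<forall>b\<in>?A. l c / u c \<le> l b / u b"
    by (meson not_less)
  have nn: "0 \<le> l c / u c" using c assms by auto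
  show ?thesis
  proof (rule that[of c "l c / u c"])
    show "\<forall>b\<in>A. l c / u c * u b \<le> l b"
    proof
      fix b assume b: "b \<in> A"
      show "l c / u c * u b \<le> l b"
      proof (cases "u b > 0")
        case True
        then have "l c / u c \<le> l b / u b" using c b by auto
        with True show ?thesis by (simp add: pos_le_divide_eq)
      next
        case False
        then have "l c / u c * u b \<le> 0" using nn by (intro mult_nonneg_nonpos) auto
        with assms b show ?thesis by fastforce
      qed
    qed
  qed (use c nn in auto)
qed

text \<open>In a combination with as few generators as possible, a linear dependence could be
  subtracted until the first coefficient reaches 0, which would save a generator.\<close>

lemma conic_combination_independent:
  fixes S :: "'v::euclidean_space set"
  assumes "finite S" "\<forall>s\<in>S. 0 \<le> l s" "y = (\<Sum>s\<in>S. l s *\<^sub>R s)"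
  shows "\<exists>A l. A \<subseteq> S \<and> independent A \<and> (\<forall>s\<in>A. 0 \<le> l s) \<and> y = (\<Sum>s\<in>A. l s *\<^sub>R s)"
proof -
  define P where "P A \<longleftrightarrow> A \<subseteq> S \<and> (\<exists>l. (\<forall>s\<in>A. 0 \<le> l s) \<and> y = (\<Sum>s\<in>A. l s *\<^sub>R s))"
    for A :: "'v set"
  have "P S" using assms by (auto simp: P_def)
  then obtain A where A: "P A" and min: "\<And>A'. P A' \<Longrightarrow> card A \<le> card A'"
    using ex_has_least_nat[of P S card] by blast
  obtain l where l: "\<forall>s\<in>A. 0 \<le> l s" "y = (\<Sum>s\<in>A. l s *\<^sub>R s)" using A by (auto simp: P_def)
  have fin: "finite A" using A assms(1) finite_subset by (auto simp: P_def)
  have "independent A"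
  proof
    assume "dependent A"
    then obtain u v where u: "v \<in> A" "u v \<noteq> 0" "(\<Sum>v\<in>A. u v *\<^sub>R v) = 0"
      using fin by (auto simp: real_vector.dependent_finite)
    obtain u' where u': "u' v > 0" "(\<Sum>v\<in>A. u' v *\<^sub>R v) = 0"
    proof (cases "u v > 0")
      case True
      with u show ?thesis using that by blast
    next
      case False
      with u show ?thesis using that[of "\<lambda>v. - u v"] by (auto simp: sum_negf)
    qed
    obtain t c where tc: "c \<in> A" "t * u' c = l c" "0 \<le> t" "\<forall>b\<in>A. t * u' b \<le> l b"
      using ratio_min[where A = A and a = v and u = u' and l = l, OF fin u(1) u'(1) l(1)] by metis
    have "(\<Sum>s\<in>A. (l s - t * u' s) *\<^sub>R s) = (\<Sum>s\<in>A. l s *\<^sub>R s) - t *\<^sub>R (\<Sum>s\<in>A. u' s *\<^sub>R s)"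
      by (simp add: scaleR_diff_left sum_subtractf scaleR_sum_right)
    then have "y = (\<Sum>s\<in>A. (l s - t * u' s) *\<^sub>R s)" using u' l by simp
    also have "\<dots> = (\<Sum>s\<in>A - {c}. (l s - t * u' s) *\<^sub>R s)"
      using fin tc by (simp add: sum.remove[of A c])
    finally have "P (A - {c})"
      using A tc unfolding P_def by (intro conjI exI[of _ "\<lambda>s. l s - t * u' s"]) auto
    from min[OF this] show False using fin tc(1) by (metis card_Diff1_less not_le)
  qed
  then show ?thesis using A l unfolding P_def by blast
qed

lemma conic_combination_basis:
  fixes S :: "'v::euclidean_space set"
  assumes "finite S" "span S = UNIV" "\<forall>s\<in>S. 0 \<le> l s" "y = (\<Sum>s\<in>S. l s *\<^sub>R s)"
  shows "\<exists>B\<subseteq>S. basis B \<and> (\<forall>b\<in>B. 0 \<le> representation B y b)"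
proof -
  obtain A l where A: "A \<subseteq> S" "independent A" "\<forall>s\<in>A. 0 \<le> l s" "y = (\<Sum>s\<in>A. l s *\<^sub>R s)"
    using conic_combination_independent[OF assms(1,3,4)] by blast
  obtain B where B: "A \<subseteq> B" "B \<subseteq> S" "independent B" "S \<subseteq> span B"
    using maximal_independent_subset_extend[OF A(1,2)] by blast
  then have bas: "basis B"
    unfolding basis_def using assms(2) by (metis UNIV_eq_I span_minimal subspace_span subset_UNIV subset_antisym)
  have "y = (\<Sum>s\<in>B. (if s \<in> A then l s else 0) *\<^sub>R s)"
    unfolding A(4) using B(1) basis_finite[OF bas]
    by (intro sum.mono_neutral_cong_left) auto
  then have "representation B y b = (if b \<in> A then l b else 0)" if "b \<in> B" for b
    using representation_unique[OF bas that, of "\<lambda>s. if s \<in> A then l s else 0"] by simp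
  then have "\<forall>b\<in>B. 0 \<le> representation B y b" using A(3) by simp
  with bas B(2) show ?thesis by blast
qed

text \<open>The maximal simplices of the regular triangulation obtained by lifting each \<open>s\<close> to height \<open>w s\<close>.\<close>

definition regular_bases :: "'v::euclidean_space set \<Rightarrow> ('v \<Rightarrow> real) \<Rightarrow> 'v set set" where
  "regular_bases S w =
    {B. B \<subseteq> S \<and> basis B \<and> (\<forall>s\<in>S - B. (\<Sum>b\<in>B. representation B s b * w b) < w s)}"

text \<open>Excludes ties, so that a failure of the strict inequality in
  \<open>regular_bases\<close> means the reverse strict inequality.\<close>

definition generic_weight :: "'v::euclidean_space set \<Rightarrow> ('v \<Rightarrow> real) \<Rightarrow> bool" where
  "generic_weight S w \<longleftrightarrow>
    (\<forall>B\<subseteq>S. basis B \<longrightarrow> (\<forall>s\<in>S - B. (\<Sum>b\<in>B. representation B s b * w b) \<noteq> w s))"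

text \<open>\<open>q\<close> avoids every hyperplane spanned by a basis from \<open>S\<close> with
  one element removed.\<close>

definition generic_point :: "'v::euclidean_space set \<Rightarrow> 'v \<Rightarrow> bool" where
  "generic_point S q \<longleftrightarrow> (\<forall>B\<subseteq>S. basis B \<longrightarrow> (\<forall>b\<in>B. representation B q b \<noteq> 0))"

text \<open>The facet opposite to \<open>b\<close> is removed exactly when \<open>q\<close> points
  out of the cone through it. For generic \<open>q\<close> these are the points that enter the open
  cone when moved slightly along \<open>q\<close>, see \<open>halfopen_cone_iff\<close>.\<close>

definition halfopen_cone :: "'v::euclidean_space set \<Rightarrow> 'v \<Rightarrow> 'v set" where
  "halfopen_cone B q =
    {x. \<forall>b\<in>B. 0 \<le> representation B x b \<and> (representation B q b < 0 \<longrightarrow> 0 < representation B x b)}"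

text \<open>One step of the simplex method. Positive weights force \<open>s\<close> to have a
  positive coordinate, so the ratio test finds an element to leave; strict positivity of the
  coordinates of \<open>y\<close> makes the step length positive, so the cost drops
  strictly.\<close>

lemma pivot:
  fixes S :: "'v::euclidean_space set"
  assumes B: "basis B" "B \<subseteq> S" and s: "s \<in> S" "s \<notin> B"
    and cost: "w s < (\<Sum>b\<in>B. representation B s b * w b)"
    and w: "\<forall>s\<in>S. 0 < w s" and y: "\<forall>b\<in>B. 0 < representation B y b"
  shows "\<exists>B'\<subseteq>S. basis B' \<and> (\<forall>b\<in>B'. 0 \<le> representation B' y b) \<and>
    (\<Sum>b\<in>B'. representation B' y b * w b) < (\<Sum>b\<in>B. representation B y b * w b)"
proof -
  let ?m = "representation B s" and ?l = "representation B y"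
  have fin: "finite B" by (rule basis_finite[OF B(1)])
  have "0 < (\<Sum>b\<in>B. ?m b * w b)" using cost w s by fastforce
  have "\<exists>a\<in>B. ?m a > 0"
  proof (rule ccontr)
    assume "\<not> ?thesis"
    then have "(\<Sum>b\<in>B. ?m b * w b) \<le> 0"
      using w B(2) by (intro sum_nonpos mult_nonpos_nonneg) (auto simp: not_less less_imp_le subsetD)
    with \<open>0 < (\<Sum>b\<in>B. ?m b * w b)\<close> show False by simp
  qed
  then obtain a where a: "a \<in> B" "?m a > 0" by blast
  obtain t c where tc: "c \<in> B" "?m c > 0" "t * ?m c = ?l c" "0 \<le> t" "\<forall>b\<in>B. t * ?m b \<le> ?l b"
    using ratio_min[where A = B and a = a and u = ?m and l = ?l, OF fin a] y by (metis less_imp_le)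
  have tpos: "t > 0" using tc y by (metis less_eq_real_def mult_zero_left order_less_irrefl)
  define B' where "B' = insert s (B - {c})"
  have s_eq: "s = (\<Sum>b\<in>B. ?m b *\<^sub>R b)" by (simp add: sum_representation B)
  have s_notin: "s \<notin> span (B - {c})"
  proof
    assume "s \<in> span (B - {c})"
    then have "representation (B - {c}) s c = 0"
      by (meson Diff_iff insertI1 real_vector.representation_ne_zero)
    moreover have "representation B s = representation (B - {c}) s"
      by (rule real_vector.representation_extend) (use B \<open>s \<in> span (B - {c})\<close> in \<open>auto simp: basis_def\<close>)
    ultimately have "?m c = 0" by metis
    with tc(2) show False by simp
  qed
  have ind': "independent B'"
    unfolding B'_def using B s_notin independent_mono[of B "B - {c}"]
    by (intro independent_insertI) (auto simp: basis_def)
  have card': "card B' = card B" 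
    unfolding B'_def using s(2) fin card_Suc_Diff1[OF fin tc(1)] by (simp add: card_insert_disjoint)
  have "UNIV \<subseteq> span B'"
    using ind' card' basis_card[OF B(1)] by (intro card_ge_dim_independent) auto
  then have bas': "basis B'" using ind' by (auto simp: basis_def)
  \<comment> \<open>Coordinates of \<open>y\<close> in the new basis: along
    \<open>s = (\<Sum>b\<in>B. ?m b *\<^sub>R b)\<close>, \<open>s\<close> enters with coefficient
    \<open>t\<close> while that of \<open>c\<close> becomes 0.\<close>
  define k where "k b = (if b = s then t else ?l b - t * ?m b)" for b
  have split: "(\<Sum>b\<in>B'. f (k b) b) = f t s + (\<Sum>b\<in>B - {c}. f (?l b - t * ?m b) b)"
    for f :: "real \<Rightarrow> 'v \<Rightarrow> 'z::comm_monoid_add"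
  proof -
    have "(\<Sum>b\<in>B'. f (k b) b) = f (k s) s + (\<Sum>b\<in>B - {c}. f (k b) b)"
      unfolding B'_def using fin s by simp
    also have "(\<Sum>b\<in>B - {c}. f (k b) b) = (\<Sum>b\<in>B - {c}. f (?l b - t * ?m b) b)"
      using s by (intro sum.cong) (auto simp: k_def)
    finally show ?thesis by (simp add: k_def)
  qed
  have "(\<Sum>b\<in>B - {c}. (?l b - t * ?m b) *\<^sub>R b) = (\<Sum>b\<in>B. (?l b - t * ?m b) *\<^sub>R b)"
    using fin tc by (simp add: sum.remove[of B c])
  also have "\<dots> = y - t *\<^sub>R s"
    using sum_representation[OF B(1), of y] sum_representation[OF B(1), of s]
    by (simp add: scaleR_diff_left sum_subtractf flip: scaleR_scaleR scaleR_sum_right)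
  finally have y_eq: "y = (\<Sum>b\<in>B'. k b *\<^sub>R b)" using split[of "\<lambda>r b. r *\<^sub>R b"] by simp
  have rep': "representation B' y b = k b" if "b \<in> B'" for b
    using representation_unique[OF bas' that] y_eq by metis
  have "(\<Sum>b\<in>B - {c}. (?l b - t * ?m b) * w b) = (\<Sum>b\<in>B. (?l b - t * ?m b) * w b)"
    using fin tc by (simp add: sum.remove[of B c])
  also have "\<dots> = (\<Sum>b\<in>B. ?l b * w b) - t * (\<Sum>b\<in>B. ?m b * w b)"
    by (simp add: left_diff_distrib sum_subtractf sum_distrib_left mult.assoc)
  also have "\<dots> < (\<Sum>b\<in>B. ?l b * w b) - t * w s" using cost tpos by simp
  finally have "(\<Sum>b\<in>B'. k b * w b) < (\<Sum>b\<in>B. ?l b * w b)" using split[of "\<lambda>r b. r * w b"] by simp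
  moreover have "\<forall>b\<in>B'. 0 \<le> k b" using tc tpos by (auto simp: B'_def k_def)
  ultimately show ?thesis
    using bas' rep' B(2) s(1) by (intro exI[of _ B'] conjI) (auto simp: B'_def)
qed

text \<open>A basis of minimal cost is regular, since otherwise a simplex pivot would lower the cost.\<close>

lemma regular_basis_exists:
  fixes S :: "'v::euclidean_space set"
  assumes S: "finite S" "span S = UNIV" and w: "generic_weight S w" "\<forall>s\<in>S. 0 < w s"
    and y: "generic_point S y" "\<forall>s\<in>S. 0 \<le> l s" "y = (\<Sum>s\<in>S. l s *\<^sub>R s)"
  shows "\<exists>B\<in>regular_bases S w. \<forall>b\<in>B. 0 < representation B y b"
proof -
  let ?C = "{B. B \<subseteq> S \<and> basis B \<and> (\<forall>b\<in>B. 0 \<le> representation B y b)}"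
  let ?cost = "\<lambda>B. \<Sum>b\<in>B. representation B y b * w b"
  have "finite ?C" using S(1) by (rule finite_subset[rotated, OF finite_Pow_iff[THEN iffD2]]) auto
  moreover have "?C \<noteq> {}" using conic_combination_basis[OF S y(2,3)] by blast
  ultimately obtain B where B: "B \<in> ?C" and min: "\<And>B'. B' \<in> ?C \<Longrightarrow> \<not> ?cost B' < ?cost B"
    using arg_min_if_finite[of ?C ?cost] by meson
  have pos: "\<forall>b\<in>B. 0 < representation B y b"
    using B y(1) unfolding generic_point_def by (metis (mono_tags, lifting) mem_Collect_eq order_less_le)
  have "(\<Sum>b\<in>B. representation B s b * w b) < w s" if s: "s \<in> S - B" for s
  proof (rule ccontr)
    assume "\<not> ?thesis"
    then have "w s < (\<Sum>b\<in>B. representation B s b * w b)"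
      using w(1) B s unfolding generic_weight_def by (metis (mono_tags, lifting) mem_Collect_eq linorder_neqE)
    then show False using pivot[of B S s w y] B s w pos min by blast
  qed
  then show ?thesis using B pos by (auto simp: regular_bases_def)
qed

text \<open>Weak duality. The cost of \<open>B\<close> is a linear functional that is at most
  \<open>w\<close> on \<open>S\<close>; evaluated at \<open>y\<close> through the coordinates of
  \<open>B'\<close> it is bounded by the cost of \<open>B'\<close>. By symmetry the costs agree, and
  since all coordinates are positive, complementary slackness gives \<open>B' \<subseteq> B\<close>
  and conversely.\<close>

lemma regular_basis_unique:
  fixes S :: "'v::euclidean_space set"
  assumes B: "B \<in> regular_bases S w" "\<forall>b\<in>B. 0 < representation B y b"
    and B': "B' \<in> regular_bases S w" "\<forall>b\<in>B'. 0 < representation B' y b"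
  shows "B = B'"
proof -
  let ?cost = "\<lambda>B y. \<Sum>b\<in>B. representation B y b * w b"
  have le: "?cost B y \<le> ?cost B' y \<and> (?cost B y = ?cost B' y \<longrightarrow> B' \<subseteq> B)"
    if B: "B \<in> regular_bases S w" and B': "B' \<in> regular_bases S w" "\<forall>b\<in>B'. 0 < representation B' y b"
    for B B'
  proof -
    have bas: "basis B" "basis B'" using B B' by (auto simp: regular_bases_def)
    note fin = this[THEN basis_finite]
    have self: "?cost B s = w s" if "s \<in> B" for s
    proof -
      have "?cost B s = (\<Sum>b\<in>B. if b = s then w b else 0)"
        using bas that by (intro sum.cong) (auto simp: basis_def real_vector.representation_basis)
      then show ?thesis using fin that by simp
    qed
    have cl: "?cost B s \<le> w s" if "s \<in> B'" for s
      using that B B' self[of s] by (cases "s \<in> B") (auto simp: regular_bases_def less_imp_le)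
    have eq: "?cost B y = (\<Sum>b'\<in>B'. representation B' y b' * ?cost B b')"
    proof -
      have "representation B y b = (\<Sum>b'\<in>B'. representation B' y b' * representation B b' b)" for b
        using representation_sum_scale[OF bas(1), of "representation B' y" "\<lambda>x. x" B' b]
        by (simp add: sum_representation bas)
      then have "?cost B y = (\<Sum>b\<in>B. \<Sum>b'\<in>B'. representation B' y b' * representation B b' b * w b)"
        by (simp add: sum_distrib_right)
      also have "\<dots> = (\<Sum>b'\<in>B'. \<Sum>b\<in>B. representation B' y b' * representation B b' b * w b)"
        by (rule sum.swap)
      finally show ?thesis by (simp add: sum_distrib_left mult.assoc)
    qed
    have "?cost B y \<le> ?cost B' y"
      unfolding eq using cl B'(2) by (intro sum_mono mult_left_mono) (auto simp: less_imp_le)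
    moreover have "B' \<subseteq> B" if *: "?cost B y = ?cost B' y"
    proof (rule ccontr)
      assume "\<not> B' \<subseteq> B"
      then obtain s where s: "s \<in> B'" "s \<notin> B" by auto
      then have "?cost B s < w s" using B B' by (auto simp: regular_bases_def)
      then have "?cost B y < ?cost B' y"
        unfolding eq using cl B'(2) fin s
        by (intro sum_strict_mono_ex1) (auto intro!: mult_left_mono bexI[of _ s] simp: less_imp_le)
      with * show False by simp
    qed
    ultimately show ?thesis by blast
  qed
  from le[OF B(1) B'] le[OF B'(1) B] show ?thesis by (meson antisym)
qed

section \<open>Infinitesimal displacement along a direction\<close>

lemma eventually_at_right_0I:
  fixes P :: "real \<Rightarrow> bool"
  assumes "0 < e" "\<And>t. 0 < t \<Longrightarrow> t < e \<Longrightarrow> P t"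
  shows "eventually P (at_right 0)"
  unfolding eventually_at_right_field by (rule exI[of _ e]) (simp add: assms)

text \<open>On the hyperplane \<open>a = 0\<close> the sign of the slope decides; this is the rule
  by which a facet is kept or removed.\<close>

lemma eventually_linear_pos_iff:
  fixes a b :: real
  assumes "b \<noteq> 0"
  shows "(\<forall>\<^sub>F t in at_right 0. 0 < a + t * b) \<longleftrightarrow> 0 \<le> a \<and> (b < 0 \<longrightarrow> 0 < a)" (is "?L \<longleftrightarrow> ?R")
    and "\<forall>\<^sub>F t in at_right 0. a + t * b \<noteq> 0"
proof -
  have lim: "((\<lambda>t. a + t * b) \<longlongrightarrow> a) (at_right 0)"
    by (rule tendsto_eq_intros | simp)+
  have pos: "\<forall>\<^sub>F t in at_right 0. 0 < a + t * b" if "0 < a"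
    using order_tendstoD(1)[OF lim that] .
  have neg: "\<forall>\<^sub>F t in at_right 0. a + t * b < 0" if "a < 0"
    using order_tendstoD(2)[OF lim that] .
  have z: "\<forall>\<^sub>F t in at_right 0. 0 < t * b \<longleftrightarrow> 0 < b" for b :: real
    by (rule eventually_at_right_0I[of 1]) (auto simp: zero_less_mult_iff)
  have nz: "\<forall>\<^sub>F t in at_right 0. t * b \<noteq> 0"
    using assms by (intro eventually_at_right_0I[of 1]) auto
  have nt: "at_right (0::real) \<noteq> bot" by (simp add: trivial_limit_at_right_real)
  show "\<forall>\<^sub>F t in at_right 0. a + t * b \<noteq> 0"
  proof (cases a "0::real" rule: linorder_cases)
    case less then show ?thesis using neg by (auto elim: eventually_mono)
  next
    case equal then show ?thesis using nz by simp
  next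
    case greater then show ?thesis using pos by (auto elim: eventually_mono)
  qed
  show "?L \<longleftrightarrow> ?R"
  proof (cases a "0::real" rule: linorder_cases)
    case less
    have "\<not> ?L"
    proof
      assume ?L
      with neg[OF less] have "\<forall>\<^sub>F t in at_right (0::real). False" by eventually_elim auto
      then show False using nt by (simp add: eventually_False)
    qed
    then show ?thesis using less by auto
  next
    case equal
    have "?L \<longleftrightarrow> (\<forall>\<^sub>F t in at_right (0::real). 0 < b)"
      using z[of b] equal by (intro eventually_subst) (auto elim: eventually_mono)
    then show ?thesis using equal assms nt by (auto simp: eventually_const)
  next
    case greater then show ?thesis using pos by auto
  qed
qed

lemma halfopen_cone_iff:
  assumes "basis B" "\<forall>b\<in>B. representation B q b \<noteq> 0"
  shows "x \<in> halfopen_cone B q \<longleftrightarrow>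
    (\<forall>\<^sub>F t in at_right 0. \<forall>b\<in>B. 0 < representation B (x + t *\<^sub>R q) b)"
proof -
  have "(\<forall>\<^sub>F t in at_right 0. \<forall>b\<in>B. 0 < representation B (x + t *\<^sub>R q) b) \<longleftrightarrow>
      (\<forall>b\<in>B. \<forall>\<^sub>F t in at_right 0. 0 < representation B x b + t * representation B q b)"
    unfolding representation_line[OF assms(1)]
    by (rule eventually_ball_finite_distrib[OF basis_finite[OF assms(1)]])
  also have "\<dots> \<longleftrightarrow> x \<in> halfopen_cone B q"
    unfolding halfopen_cone_def mem_Collect_eq
    by (intro ball_cong refl eventually_linear_pos_iff(1)) (use assms(2) in blast)
  finally show ?thesis by simp
qed

lemma eventually_generic_point:
  assumes "finite S" "generic_point S q"
  shows "\<forall>\<^sub>F t in at_right 0. generic_point S (x + t *\<^sub>R q)"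
proof -
  have "\<forall>\<^sub>F t in at_right 0. \<forall>B\<in>{B. B \<subseteq> S \<and> basis B}. \<forall>b\<in>B. representation B (x + t *\<^sub>R q) b \<noteq> 0"
  proof (intro eventually_ball_finite ballI)
    show "finite {B. B \<subseteq> S \<and> basis B}"
      using assms(1) by (rule finite_subset[rotated, OF finite_Pow_iff[THEN iffD2]]) auto
  next
    fix B b assume "B \<in> {B. B \<subseteq> S \<and> basis B}" "b \<in> B"
    then show "\<forall>\<^sub>F t in at_right 0. representation B (x + t *\<^sub>R q) b \<noteq> 0"
      using assms(2) by (simp add: representation_line generic_point_def eventually_linear_pos_iff(2))
  qed (auto simp: basis_finite)
  then show ?thesis by (rule eventually_mono) (auto simp: generic_point_def)
qed

text \<open>For small \<open>t\<close> the displaced point is generic and still in the cone, so it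
  has exactly one regular basis with positive coordinates. That basis could still vary with
  \<open>t\<close>; finiteness of the set of bases settles this.\<close>

theorem halfopen_decomposition:
  fixes S :: "'v::euclidean_space set"
  assumes S: "finite S" "span S = UNIV" and w: "generic_weight S w" "\<forall>s\<in>S. 0 < w s"
    and q: "generic_point S q"
    and x: "\<forall>\<^sub>F t in at_right 0. \<exists>l. (\<forall>s\<in>S. 0 \<le> l s) \<and> x + t *\<^sub>R q = (\<Sum>s\<in>S. l s *\<^sub>R s)"
  shows "\<exists>!B. B \<in> regular_bases S w \<and> x \<in> halfopen_cone B q"
proof -
  have iff: "x \<in> halfopen_cone B q \<longleftrightarrow> 
      (\<forall>\<^sub>F t in at_right 0. \<forall>b\<in>B. 0 < representation B (x + t *\<^sub>R q) b)"
    if "B \<in> regular_bases S w" for B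
    using that q by (intro halfopen_cone_iff) (auto simp: regular_bases_def generic_point_def)
  have nt: "at_right (0::real) \<noteq> bot" by (simp add: trivial_limit_at_right_real)
  have finR: "finite (regular_bases S w)"
    using S(1) by (rule finite_subset[rotated, OF finite_Pow_iff[THEN iffD2]]) (auto simp: regular_bases_def)
  \<comment> \<open>For small \<open>t\<close>, positivity at that one \<open>t\<close> already
    implies membership of \<open>x\<close>: otherwise some coordinate would be negative for all
    small \<open>t\<close>. So the basis found at any single small \<open>t\<close> will do.\<close>
  have sign: "\<forall>\<^sub>F t in at_right 0. (\<forall>b\<in>B. 0 < representation B (x + t *\<^sub>R q) b) \<longrightarrow> x \<in> halfopen_cone B q"
    if B: "B \<in> regular_bases S w" for B
  proof (cases "x \<in> halfopen_cone B q")
    case False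
    have bas: "basis B" "\<forall>b\<in>B. representation B q b \<noteq> 0"
      using B q by (auto simp: regular_bases_def generic_point_def)
    obtain b where b: "b \<in> B" "representation B x b < 0 \<or> representation B x b = 0 \<and> representation B q b < 0"
      using False by (force simp: halfopen_cone_def)
    have "\<forall>\<^sub>F t in at_right 0. 0 < (- representation B x b) + t * (- representation B q b)"
      using b bas by (subst eventually_linear_pos_iff) auto
    then show ?thesis
      by (rule eventually_mono) (use b bas in \<open>force simp: representation_line\<close>)
  qed auto
  have "\<forall>\<^sub>F t in at_right 0. \<forall>B\<in>regular_bases S w.
      (\<forall>b\<in>B. 0 < representation B (x + t *\<^sub>R q) b) \<longrightarrow> x \<in> halfopen_cone B q"
    using sign finR by (intro eventually_ball_finite) auto
  with x eventually_generic_point[OF S(1) q, of x]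
  have "\<forall>\<^sub>F t in at_right (0::real). \<exists>B\<in>regular_bases S w. x \<in> halfopen_cone B q"
  proof eventually_elim
    case (elim t)
    then obtain l where "\<forall>s\<in>S. 0 \<le> l s" "x + t *\<^sub>R q = (\<Sum>s\<in>S. l s *\<^sub>R s)" by blast
    from regular_basis_exists[OF S w elim(2) this] elim(3) show ?case by blast
  qed
  then have ex: "\<exists>B\<in>regular_bases S w. x \<in> halfopen_cone B q"
    using nt by (simp add: eventually_const)
  moreover have "B = B'"
    if "B \<in> regular_bases S w" "x \<in> halfopen_cone B q" "B' \<in> regular_bases S w" "x \<in> halfopen_cone B' q" for B B'
  proof -
    have "\<forall>\<^sub>F t in at_right (0::real). B = B'"
      using that(2)[unfolded iff[OF that(1)]] that(4)[unfolded iff[OF that(3)]]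
      by eventually_elim (use regular_basis_unique that in blast)
    then show ?thesis using nt by (simp add: eventually_const)
  qed
  ultimately show ?thesis by blast
qed

section \<open>Lattice points in half-open simplices\<close>

definition compositions :: "'i set \<Rightarrow> nat \<Rightarrow> ('i \<Rightarrow> nat) set" where
  "compositions B N = {g \<in> extensional B. sum g B = N}"

lemma finite_compositions: "finite B \<Longrightarrow> finite (compositions B N)"
proof (rule finite_subset)
  assume "finite B"
  then show "compositions B N \<subseteq> B \<rightarrow>\<^sub>E {..N}"
    by (auto simp: compositions_def PiE_def extensional_def intro: member_le_sum)
  show "finite B \<Longrightarrow> finite (B \<rightarrow>\<^sub>E {..N})" by (simp add: finite_PiE)
qed

lemma card_compositions:
  assumes "finite B" "B \<noteq> {}"
  shows "card (compositions B N) = (N + card B - 1) choose (card B - 1)"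
  using assms
proof (induction B arbitrary: N rule: finite_ne_induct)
  case (singleton b)
  have "compositions {b} N = {\<lambda>x. if x = b then N else undefined}"
    by (auto simp: compositions_def extensional_def)
  then show ?case by simp
next
  case (insert b F)
  let ?h = "\<lambda>(i, g). g(b := i)"
  have "bij_betw ?h (SIGMA i:{..N}. compositions F (N - i)) (compositions (insert b F) N)"
  proof (rule bij_betw_byWitness[where f' = "\<lambda>g. (g b, g(b := undefined))"])
    show "\<forall>a\<in>SIGMA i:{..N}. compositions F (N - i). (\<lambda>g. (g b, g(b := undefined))) (?h a) = a"
      using insert by (auto simp: compositions_def extensional_def)
    have 1: "(\<Sum>x\<in>F. if x = b then i else g x) = sum g F" for g and i :: nat
      using insert by (intro sum.cong) auto
    show "?h ` (SIGMA i:{..N}. compositions F (N - i)) \<subseteq> compositions (insert b F) N"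
      using insert by (auto simp: compositions_def extensional_def 1)
    show "(\<lambda>g. (g b, g(b := undefined))) ` compositions (insert b F) N \<subseteq> (SIGMA i:{..N}. compositions F (N - i))"
      using insert by (auto simp: compositions_def extensional_def 1)
  qed (use insert in auto)
  then have "card (compositions (insert b F) N) = card (SIGMA i:{..N}. compositions F (N - i))"
    using bij_betw_same_card by metis
  also have "\<dots> = (\<Sum>i\<le>N. (N - i + card F - 1) choose (card F - 1))"
    using insert by (simp add: card_SigmaI finite_compositions)
  also have "\<dots> = (\<Sum>i\<le>N. (i + card F - 1) choose (card F - 1))"
    by (rule sum.reindex_bij_witness[of _ "\<lambda>i. N - i" "\<lambda>i. N - i"]) auto
  also have "\<dots> = (\<Sum>i\<le>N. ((card F - 1) + i) choose (card F - 1))"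
    using insert by (intro sum.cong) (auto simp: card_gt_0_iff Suc_le_eq intro!: arg_cong2[where f = binomial])
  also have "\<dots> = (card F - 1 + N + 1) choose (card F - 1 + 1)"
    by (rule choose_rising_sum(1))
  also have "card F - 1 + N + 1 = N + card (insert b F) - 1"
    using insert by (simp add: card_gt_0_iff Suc_le_eq)
  also have "card F - 1 + 1 = card (insert b F) - 1"
    using insert by (simp add: card_gt_0_iff)
  finally show ?case .
qed

text \<open>
  Lattice points of the \<open>n\<close>-th dilate of the simplex with vertices \<open>p b\<close>, given by their barycentric
  coordinates; the facets opposite to the vertices in \<open>J\<close> are removed. The box points are those in the
  half-open fundamental parallelepiped, at height \<open>k\<close>.
\<close>

definition weighted_points :: "('i \<Rightarrow> real ^ 'n) \<Rightarrow> 'i set \<Rightarrow> 'i set \<Rightarrow> nat \<Rightarrow> ('i \<Rightarrow> real) set" where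
  "weighted_points p B J n = {l \<in> extensional B. (\<forall>b\<in>B. 0 \<le> l b \<and> (b \<in> J \<longrightarrow> 0 < l b)) \<and>
    sum l B = real n \<and> (\<Sum>b\<in>B. l b *\<^sub>R p b) \<in> integer_points}"

definition box_points :: "('i \<Rightarrow> real ^ 'n) \<Rightarrow> 'i set \<Rightarrow> 'i set \<Rightarrow> nat \<Rightarrow> ('i \<Rightarrow> real) set" where
  "box_points p B J k = {l \<in> weighted_points p B J k. \<forall>b\<in>B. l b \<le> 1 \<and> (b \<notin> J \<longrightarrow> l b < 1)}"

lemma integer_points_add: "x \<in> integer_points \<Longrightarrow> y \<in> integer_points \<Longrightarrow> x + y \<in> integer_points"
  and integer_points_diff: "x \<in> integer_points \<Longrightarrow> y \<in> integer_points \<Longrightarrow> x - y \<in> integer_points"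
  by (auto simp: integer_points_def)

lemma integer_points_sum:
  assumes "\<And>b. b \<in> B \<Longrightarrow> p b \<in> integer_points"
  shows "(\<Sum>b\<in>B. real (g b) *\<^sub>R p b) \<in> integer_points"
  using assms by (auto simp: integer_points_def intro!: Ints_sum)

lemma finite_integer_points_bounded:
  fixes M :: real
  shows "finite {x :: real ^ 'n. x \<in> integer_points \<and> (\<forall>i. \<bar>x $ i\<bar> \<le> M)}" (is "finite ?A")
proof -
  have "?A \<subseteq> (\<lambda>f. \<chi> i. of_int (f i)) ` (UNIV \<rightarrow>\<^sub>E {- \<lceil>M\<rceil>..\<lceil>M\<rceil>})"
  proof
    fix x :: "real ^ 'n" assume x: "x \<in> ?A"
    have "x = (\<chi> i. of_int \<lfloor>x $ i\<rfloor>)"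
      using x by (auto simp: vec_eq_iff integer_points_def)
    moreover have "\<lfloor>x $ i\<rfloor> \<in> {- \<lceil>M\<rceil>..\<lceil>M\<rceil>}" for i
    proof -
      have "\<bar>x $ i\<bar> \<le> M" using x by auto
      then show ?thesis by (simp add: abs_le_iff) linarith
    qed
    ultimately show "x \<in> (\<lambda>f. \<chi> i. of_int (f i)) ` (UNIV \<rightarrow>\<^sub>E {- \<lceil>M\<rceil>..\<lceil>M\<rceil>})"
      by (intro image_eqI[of _ _ "\<lambda>i. \<lfloor>x $ i\<rfloor>"]) auto
  qed
  then show ?thesis by (rule finite_subset) (intro finite_imageI finite_PiE, auto)
qed

text \<open>The hypothesis \<open>inj\<close> stands for affine independence of the vertices. The
  points themselves are integral and bounded, hence finite in number.\<close>

lemma finite_weighted_points: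
  fixes p :: "'i \<Rightarrow> real ^ 'n"
  assumes B: "finite B"
    and inj: "inj_on (\<lambda>l. \<Sum>b\<in>B. l b *\<^sub>R p b) {l \<in> extensional B. sum l B = real n}"
  shows "finite (weighted_points p B J n)"
proof -
  let ?f = "\<lambda>l. \<Sum>b\<in>B. l b *\<^sub>R p b"
  let ?M = "real n * (\<Sum>b\<in>B. norm (p b))"
  have "\<bar>?f l $ i\<bar> \<le> ?M" if l: "l \<in> weighted_points p B J n" for l i
  proof -
    have le: "l b \<le> real n" if "b \<in> B" for b
      using l that member_le_sum[OF that _ B, of l] by (auto simp: weighted_points_def)
    have "\<bar>?f l $ i\<bar> \<le> norm (?f l)" by (rule component_le_norm_cart)
    also have "\<dots> \<le> (\<Sum>b\<in>B. norm (l b *\<^sub>R p b))" by (rule norm_sum)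
    also have "\<dots> \<le> (\<Sum>b\<in>B. real n * norm (p b))"
      using l le by (intro sum_mono) (auto simp: weighted_points_def intro!: mult_right_mono)
    finally show ?thesis by (simp add: sum_distrib_left)
  qed
  then have "?f ` weighted_points p B J n \<subseteq> {x. x \<in> integer_points \<and> (\<forall>i. \<bar>x $ i\<bar> \<le> ?M)}"
    by (auto simp: weighted_points_def)
  then have "finite (?f ` weighted_points p B J n)"
    using finite_integer_points_bounded finite_subset by blast
  moreover have "inj_on ?f (weighted_points p B J n)"
    using inj by (rule inj_on_subset) (auto simp: weighted_points_def)
  ultimately show ?thesis by (rule finite_imageD)
qed

lemma box_points_empty:
  assumes "finite B" "card B < k"
  shows "box_points p B J k = {}"
proof -
  have "sum l B \<le> real (card B)" if "l \<in> box_points p B J k" for l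
    using that sum_mono[of B l "\<lambda>_. 1"] by (auto simp: box_points_def)
  then show ?thesis using assms(2) by (force simp: box_points_def weighted_points_def)
qed

text \<open>The map \<open>l \<mapsto> 1 - l\<close> exchanges the intervals \<open>[0,1)\<close>
  and \<open>(0,1]\<close>, hence \<open>J\<close> and its complement. It preserves integrality
  because the sum of all vertices is integral.\<close>

lemma card_box_points_reflect:
  assumes B: "finite B" "k \<le> card B" and p: "\<And>b. b \<in> B \<Longrightarrow> p b \<in> integer_points"
  shows "card (box_points p B (B - J) k) = card (box_points p B J (card B - k))"
proof -
  let ?f = "\<lambda>l. restrict (\<lambda>b. 1 - l b) B"
  have sum: "(\<Sum>b\<in>B. (1 - l b) *\<^sub>R p b) = (\<Sum>b\<in>B. real 1 *\<^sub>R p b) - (\<Sum>b\<in>B. l b *\<^sub>R p b)" for l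
    by (simp add: scaleR_diff_left sum_subtractf)
  have int: "(\<Sum>b\<in>B. (1 - l b) *\<^sub>R p b) \<in> integer_points" if "(\<Sum>b\<in>B. l b *\<^sub>R p b) \<in> integer_points" for l
    unfolding sum using that integer_points_sum[of B p "\<lambda>_. 1"] p by (intro integer_points_diff) auto
  have sub: "?f ` box_points p B (B - J) k \<subseteq> box_points p B J (card B - k)" if "k \<le> card B" for J k
    using int that B
    by (auto simp: box_points_def weighted_points_def sum_subtractf of_nat_diff)
  have "bij_betw ?f (box_points p B (B - J) k) (box_points p B J (card B - k))"
  proof (rule bij_betw_byWitness[where f' = ?f])
    show "\<forall>a\<in>box_points p B (B - J) k. ?f (?f a) = a"
      by (auto simp: box_points_def weighted_points_def extensional_def)
    show "\<forall>a\<in>box_points p B J (card B - k). ?f (?f a) = a"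
      by (auto simp: box_points_def weighted_points_def extensional_def)
    have "box_points p B (B - (B - J)) (card B - k) = box_points p B J (card B - k)"
      by (auto simp: box_points_def weighted_points_def)
    then show "?f ` box_points p B J (card B - k) \<subseteq> box_points p B (B - J) k"
      using sub[of "card B - k" "B - J"] B(2) by simp
  qed (rule sub[OF B(2)])
  then show ?thesis by (rule bij_betw_same_card)
qed

text \<open>Every weight splits uniquely into a box part and a natural number. A box point at height
  \<open>k\<close> leaves \<open>n - k\<close> to be distributed over \<open>B\<close>, which is
  counted by compositions.\<close>

lemma card_weighted_points:
  assumes B: "finite B" "B \<noteq> {}" and n: "n > 0"
    and p: "\<And>b. b \<in> B \<Longrightarrow> p b \<in> integer_points"
    and fin: "\<And>k. finite (box_points p B J k)"
  shows "card (weighted_points p B J n) =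
    (\<Sum>k\<le>card B. card (box_points p B J k) * ((n + card B - 1 - k) choose (card B - 1)))"
proof -
  let ?D = "SIGMA k:{..min n (card B)}. box_points p B J k \<times> compositions B (n - k)"
  let ?h = "\<lambda>(k::nat, l, g). restrict (\<lambda>b. l b + real (g b)) B"
  \<comment> \<open>The integer part, adapted to the half-open box: for \<open>b\<close> in
    \<open>J\<close> the remainder must lie in \<open>(0,1]\<close>, hence the ceiling minus
    1.\<close>
  define fl where "fl l b = (if b \<in> J then nat (\<lceil>l b\<rceil> - 1) else nat \<lfloor>l b\<rfloor>)"
    for l :: "'a \<Rightarrow> real" and b
  define fp where "fp l = restrict (\<lambda>b. l b - real (fl l b)) B" for l
  let ?h' = "\<lambda>l. (n - sum (fl l) B, fp l, restrict (fl l) B)"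
  have "bij_betw ?h ?D (weighted_points p B J n)"
  proof (rule bij_betw_byWitness[where f' = ?h'])
    show "?h ` ?D \<subseteq> weighted_points p B J n"
    proof clarify
      fix k l g assume *: "k \<le> min n (card B)" "l \<in> box_points p B J k" "g \<in> compositions B (n - k)"
      have "(\<Sum>b\<in>B. (l b + real (g b)) *\<^sub>R p b) \<in> integer_points"
        using * integer_points_sum[of B p g] p
        by (auto simp: scaleR_add_left sum.distrib box_points_def weighted_points_def intro: integer_points_add)
      moreover have "(\<Sum>b\<in>B. l b + real (g b)) = real n"
        using * by (auto simp: sum.distrib box_points_def weighted_points_def compositions_def simp flip: of_nat_sum)
      ultimately show "restrict (\<lambda>b. l b + real (g b)) B \<in> weighted_points p B J n"
        using * by (auto simp: box_points_def weighted_points_def intro: add_pos_nonneg)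
    qed
    have fl: "real (fl l b) \<le> l b" "l b \<le> real (fl l b) + 1"
        "b \<in> J \<Longrightarrow> real (fl l b) < l b" "b \<notin> J \<Longrightarrow> l b < real (fl l b) + 1"
      if "l \<in> weighted_points p B J n" "b \<in> B" for l b
    proof -
      have "0 \<le> l b" "b \<in> J \<Longrightarrow> 0 < l b" using that by (auto simp: weighted_points_def)
      moreover have "b \<in> J \<Longrightarrow> 0 < l b \<Longrightarrow> 1 \<le> \<lceil>l b\<rceil>" by linarith
      ultimately show "real (fl l b) \<le> l b" "l b \<le> real (fl l b) + 1"
        "b \<in> J \<Longrightarrow> real (fl l b) < l b" "b \<notin> J \<Longrightarrow> l b < real (fl l b) + 1"
        unfolding fl_def by (auto simp: of_nat_nat) linarith+
    qed
    show "?h' ` weighted_points p B J n \<subseteq> ?D"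
    proof (rule image_subsetI)
      fix l assume l: "l \<in> weighted_points p B J n"
      let ?N = "sum (fl l) B"
      have "real ?N \<le> sum l B" using fl(1)[OF l] by (auto intro!: sum_mono)
      also have "sum l B = real n" using l by (simp add: weighted_points_def)
      finally have N: "?N \<le> n" by (simp only: of_nat_le_iff)
      have sum_fp: "sum (fp l) B = real (n - ?N)"
        using l N by (auto simp: fp_def sum_subtractf of_nat_diff weighted_points_def)
      have "(\<Sum>b\<in>B. (l b - real (fl l b)) *\<^sub>R p b) \<in> integer_points"
        using l integer_points_sum[of B p "fl l"] p
        by (auto simp: scaleR_diff_left sum_subtractf weighted_points_def intro: integer_points_diff)
      then have box: "fp l \<in> box_points p B J (n - ?N)"
        using fl[OF l] sum_fp unfolding box_points_def weighted_points_def
        by (fastforce simp: fp_def)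
      have "n - ?N \<le> card B"
        using box box_points_empty[OF B(1)] by (metis empty_iff not_le)
      then show "(n - ?N, fp l, restrict (fl l) B) \<in> ?D"
        using box N by (auto simp: compositions_def)
    qed
    show "\<forall>l\<in>weighted_points p B J n. ?h (?h' l) = l"
      by (auto simp: fp_def weighted_points_def extensional_def)
    show "\<forall>a\<in>?D. ?h' (?h a) = a"
    proof
      fix a assume "a \<in> ?D"
      then obtain k l g where a: "a = (k, l, g)" and
        *: "k \<le> min n (card B)" "l \<in> box_points p B J k" "g \<in> compositions B (n - k)"
        by blast
      let ?l = "restrict (\<lambda>b. l b + real (g b)) B"
      have fl_eq: "fl ?l b = g b" if "b \<in> B" for b
      proof -
        have "0 \<le> l b" "l b \<le> 1" "b \<in> J \<Longrightarrow> 0 < l b" "b \<notin> J \<Longrightarrow> l b < 1"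
          using * that by (auto simp: box_points_def weighted_points_def)
        moreover have "\<lceil>l b + real (g b)\<rceil> = int (g b) + 1" if "0 < l b" "l b \<le> 1"
          using that by (intro ceiling_unique) auto
        moreover have "\<lfloor>l b + real (g b)\<rfloor> = int (g b)" if "0 \<le> l b" "l b < 1"
          using that by (intro floor_unique) auto
        ultimately show ?thesis using that by (auto simp: fl_def)
      qed
      have 1: "sum (fl ?l) B = n - k" using fl_eq * by (simp add: compositions_def)
      have 2: "fp ?l = l" using fl_eq * 
        by (auto simp: fp_def box_points_def weighted_points_def extensional_def)
      have 3: "restrict (fl ?l) B = g" using fl_eq * by (auto simp: compositions_def extensional_def)
      have "?h a = ?l" by (simp add: a)
      then show "?h' (?h a) = a" using 1 2 3 *(1) by (simp add: a)
    qed
  qed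
  then have "card (weighted_points p B J n) = card ?D" by (simp add: bij_betw_same_card)
  also have "\<dots> = (\<Sum>k\<le>min n (card B). card (box_points p B J k) * card (compositions B (n - k)))"
    using fin B(1) by (subst card_SigmaI) (auto simp: finite_compositions card_cartesian_product)
  also have "\<dots> = (\<Sum>k\<le>min n (card B). card (box_points p B J k) * ((n + card B - 1 - k) choose (card B - 1)))"
    by (intro sum.cong) (auto simp: card_compositions[OF B])
  \<comment> \<open>The added terms have \<open>k > n\<close> and a vanishing binomial;
    \<open>n > 0\<close> and \<open>k \<le> card B\<close> ensure that the subtraction is not
    truncated.\<close>
  also have "\<dots> = (\<Sum>k\<le>card B. card (box_points p B J k) * ((n + card B - 1 - k) choose (card B - 1)))"
    using n by (intro sum.mono_neutral_left) (auto intro!: binomial_eq_0)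
  finally show ?thesis .
qed

section \<open>Generic points and weights\<close>

text \<open>The points to avoid lie on finitely many hyperplanes, a negligible set that cannot
  contain a nonempty open set.\<close>

lemma generic_point_exists:
  fixes S :: "'v::euclidean_space set"
  assumes S: "finite S" and U: "open U" "U \<noteq> {}"
  shows "\<exists>q\<in>U. generic_point S q"
proof -
  let ?Bs = "{B. B \<subseteq> S \<and> basis B}"
  let ?N = "\<Union>((\<lambda>(B, b). {x. representation B x b = 0}) ` (SIGMA B:?Bs. B))"
  have fin: "finite (SIGMA B:?Bs. B)"
    using S by (intro finite_SigmaI) (auto simp: basis_finite)
  have neg: "negligible {x. representation B x b = 0}" if B: "basis B" "b \<in> B" for B :: "'v set" and b
  proof -
    have "{x. representation B x b = 0} \<subseteq> span (B - {b})"
    proof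
      fix x assume "x \<in> {x. representation B x b = 0}"
      then have "x = (\<Sum>v\<in>B - {b}. representation B x v *\<^sub>R v)"
        using sum_representation[OF B(1), of x] basis_finite[OF B(1)] B(2)
        by (simp add: sum.remove[of B b])
      also have "\<dots> \<in> span (B - {b})"
        by (intro span_sum span_scale span_base)
      finally show "x \<in> span (B - {b})" .
    qed
    moreover have "dim (span (B - {b})) < DIM('v)"
    proof -
      have "dim (span (B - {b})) \<le> card (B - {b})"
        using basis_finite[OF B(1)] by (simp add: dim_le_card')
      also have "\<dots> < card B" using B basis_finite by (metis card_Diff1_less)
      finally show ?thesis using basis_card[OF B(1)] by simp
    qed
    ultimately show ?thesis using negligible_lowdim negligible_subset by blast
  qed
  have "negligible ?N"
    using fin neg by (intro negligible_Union) auto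
  then have "\<not> U \<subseteq> ?N" using open_not_negligible[OF U] negligible_subset by blast
  then show ?thesis by (fastforce simp: generic_point_def)
qed

text \<open>Distinct powers of \<open>t\<close> prevent linear coincidences between the weights, and
  the weights tend to 1 as \<open>t\<close> tends to 0. \<open>Suc\<close> keeps the powers apart
  from the constant term.\<close>

definition power_weight :: "('a \<Rightarrow> nat) \<Rightarrow> real \<Rightarrow> 'a \<Rightarrow> real" where
  "power_weight f t s = 1 + t ^ Suc (f s)"

lemma eventually_poly_nonzero:
  fixes p :: "real poly"
  assumes "p \<noteq> 0"
  shows "\<forall>\<^sub>F t in at_right 0. poly p t \<noteq> 0"
proof -
  have "\<not> 0 islimpt {x. poly p x = 0}"
    using poly_roots_finite[OF assms] by (rule islimpt_finite)
  then have "\<forall>\<^sub>F t in at 0. poly p t \<noteq> 0" by (simp add: islimpt_iff_eventually)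
  then show ?thesis by (simp add: eventually_at_split)
qed

lemma eventually_generic_weight:
  fixes S :: "'v::euclidean_space set"
  assumes S: "finite S" and f: "inj_on f S"
  shows "\<forall>\<^sub>F t in at_right 0. generic_weight S (power_weight f t)"
proof -
  have 1: "\<forall>\<^sub>F t in at_right 0.
      (\<Sum>b\<in>B. representation B s b * power_weight f t b) \<noteq> power_weight f t s"
    if B: "B \<subseteq> S" "basis B" and s: "s \<in> S - B" for B s
  proof -
    define p where "p = (\<Sum>b\<in>B. smult (representation B s b) (1 + monom 1 (Suc (f b)))) - (1 + monom 1 (Suc (f s)))"
    \<comment> \<open>This coefficient is -1: \<open>s\<close> is not in \<open>B\<close> and
      \<open>f\<close> is injective, so no term of the sum contributes to this power.\<close>
    have "coeff p (Suc (f s)) = (\<Sum>b\<in>B. representation B s b * (if f b = f s then 1 else 0)) - 1"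
      by (simp add: p_def coeff_sum)
    also have "(\<Sum>b\<in>B. representation B s b * (if f b = f s then 1 else 0)) = 0"
      using B s f by (intro sum.neutral) (auto simp: inj_on_def)
    finally have "p \<noteq> 0" by auto
    moreover have "poly p t = (\<Sum>b\<in>B. representation B s b * power_weight f t b) - power_weight f t s" for t
      by (simp add: p_def poly_sum poly_monom power_weight_def)
    ultimately show ?thesis using eventually_poly_nonzero[of p] by simp
  qed
  have "\<forall>\<^sub>F t in at_right 0. \<forall>B\<in>{B. B \<subseteq> S \<and> basis B}. \<forall>s\<in>S - B.
      (\<Sum>b\<in>B. representation B s b * power_weight f t b) \<noteq> power_weight f t s"
    using S 1 by (intro eventually_ball_finite ballI) auto
  then show ?thesis by (rule eventually_mono) (auto simp: generic_weight_def)
qed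

text \<open>A basis with coordinate sum above 1 at some \<open>s\<close> would violate regularity
  for all weights close enough to 1. The bound on coordinate sums is what places the fan's simplices
  on the boundary of \<open>P\<close>.\<close>

lemma generic_weight_near_one:
  fixes S :: "'v::euclidean_space set"
  assumes S: "finite S"
  shows "\<exists>w. generic_weight S w \<and> (\<forall>s\<in>S. 0 < w s) \<and>
    (\<forall>B\<in>regular_bases S w. \<forall>s\<in>S. (\<Sum>b\<in>B. representation B s b) \<le> 1)"
proof -
  obtain f :: "'v \<Rightarrow> nat" where f: "inj_on f S" using finite_imp_inj_to_nat_seg[OF S] by blast
  have lim: "((\<lambda>t. power_weight f t s) \<longlongrightarrow> 1) (at_right 0)" for s
    unfolding power_weight_def by (rule tendsto_eq_intros | simp)+
  have 1: "\<forall>\<^sub>F t in at_right 0. 1 < (\<Sum>b\<in>B. representation B s b) \<longrightarrow>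
      power_weight f t s < (\<Sum>b\<in>B. representation B s b * power_weight f t b)"
    if B: "B \<subseteq> S" "basis B" and s: "s \<in> S" for B s
  proof (cases "1 < (\<Sum>b\<in>B. representation B s b)")
    case True
    have "((\<lambda>t. (\<Sum>b\<in>B. representation B s b * power_weight f t b) - power_weight f t s) \<longlongrightarrow>
      (\<Sum>b\<in>B. representation B s b * 1) - 1) (at_right 0)"
      by (intro tendsto_intros lim)
    from order_tendstoD(1)[OF this, of 0] True show ?thesis
      by (auto elim: eventually_mono)
  qed auto
  have 2: "\<forall>\<^sub>F t in at_right 0. \<forall>B\<in>{B. B \<subseteq> S \<and> basis B}. \<forall>s\<in>S. 1 < (\<Sum>b\<in>B. representation B s b) \<longrightarrow>
      power_weight f t s < (\<Sum>b\<in>B. representation B s b * power_weight f t b)"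
    using S 1 by (intro eventually_ball_finite ballI) auto
  have "\<forall>\<^sub>F t in at_right 0. \<forall>s\<in>S. 0 < power_weight f t s"
    using S order_tendstoD(1)[OF lim, of 0] by (intro eventually_ball_finite) auto
  with 2 eventually_generic_weight[OF S f]
  have "\<forall>\<^sub>F t in at_right 0. generic_weight S (power_weight f t) \<and> (\<forall>s\<in>S. 0 < power_weight f t s) \<and>
      (\<forall>B\<in>regular_bases S (power_weight f t). \<forall>s\<in>S. (\<Sum>b\<in>B. representation B s b) \<le> 1)"
  proof eventually_elim
    case (elim t)
    have "(\<Sum>b\<in>B. representation B s b) \<le> 1" if B: "B \<in> regular_bases S (power_weight f t)" and s: "s \<in> S" for B s
    proof (cases "s \<in> B")
      case True
      have "basis B" using B by (simp add: regular_bases_def)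
      then have "(\<Sum>b\<in>B. representation B s b) = (\<Sum>b\<in>B. if s = b then 1 else 0)"
        using True by (intro sum.cong) (auto simp: basis_def real_vector.representation_basis)
      then show ?thesis using \<open>basis B\<close> True by (simp add: basis_finite)
    next
      case False
      then have "(\<Sum>b\<in>B. representation B s b * power_weight f t b) < power_weight f t s"
        using B s by (auto simp: regular_bases_def)
      moreover have "B \<in> {B. B \<subseteq> S \<and> basis B}" using B by (auto simp: regular_bases_def)
      with elim(1) s have "1 < (\<Sum>b\<in>B. representation B s b) \<longrightarrow>
          power_weight f t s < (\<Sum>b\<in>B. representation B s b * power_weight f t b)" by blast
      ultimately show ?thesis by linarith
    qed
    then show ?case using elim by blast
  qed
  then show ?thesis using eventually_happens'[OF trivial_limit_at_right_real] by blast
qed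

section \<open>Counting over a disjoint union of half-open simplices\<close>

lemma halfopen_cone_iff_sum:
  assumes B: "basis B"
  shows "(\<Sum>b\<in>B. l b *\<^sub>R b) \<in> halfopen_cone B q \<longleftrightarrow>
    (\<forall>b\<in>B. 0 \<le> l b \<and> (b \<in> {b. representation B q b < 0} \<longrightarrow> 0 < l b))"
  using B by (auto simp: halfopen_cone_def representation_unique)

lemma basis_combination_inj:
  assumes B: "basis B" and l: "l \<in> extensional B" "l' \<in> extensional B"
    and eq: "(\<Sum>b\<in>B. l b *\<^sub>R b) = (\<Sum>b\<in>B. l' b *\<^sub>R b)"
  shows "l = l'"
proof (rule extensionalityI[OF l])
  fix b assume "b \<in> B"
  then show "l b = l' b" using representation_unique[OF B] eq by metis
qed

text \<open>The vertex map \<open>p\<close> is kept general because it is used as \<open>fst\<close>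
  on the cone over \<open>P\<close>, as \<open>b + c\<close> on the fan, and as \<open>pt\<close> on
  the simplex in dimension 15.\<close>

lemma card_UN_weighted_points:
  assumes Bs: "finite Bs" "0 < n" "0 < m"
    and B: "\<And>B. B \<in> Bs \<Longrightarrow> finite B \<and> card B = m"
    and p: "\<And>B b. B \<in> Bs \<Longrightarrow> b \<in> B \<Longrightarrow> p b \<in> integer_points"
    and inj: "\<And>B k. B \<in> Bs \<Longrightarrow> inj_on (\<lambda>l. \<Sum>b\<in>B. l b *\<^sub>R p b) {l \<in> extensional B. sum l B = real k}"
    and disj: "\<And>B B' l l'. B \<in> Bs \<Longrightarrow> B' \<in> Bs \<Longrightarrow> l \<in> weighted_points p B (J B) n \<Longrightarrow>
      l' \<in> weighted_points p B' (J B') n \<Longrightarrow> (\<Sum>b\<in>B. l b *\<^sub>R p b) = (\<Sum>b\<in>B'. l' b *\<^sub>R p b) \<Longrightarrow> B = B'"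
  shows "card (\<Union>B\<in>Bs. (\<lambda>l. \<Sum>b\<in>B. l b *\<^sub>R p b) ` weighted_points p B (J B) n) =
    (\<Sum>k\<le>m. (\<Sum>B\<in>Bs. card (box_points p B (J B) k)) * ((n + m - 1 - k) choose (m - 1)))"
    (is "card (\<Union>B\<in>Bs. ?A B) = _")
proof -
  have finw: "finite (weighted_points p B J k)" if "B \<in> Bs" for B J k
    using finite_weighted_points inj[OF that] B[OF that] by blast
  have finb: "finite (box_points p B J k)" if "B \<in> Bs" for B J k
    using finw[OF that] by (rule finite_subset[rotated]) (auto simp: box_points_def)
  have "card (\<Union>B\<in>Bs. ?A B) = (\<Sum>B\<in>Bs. card (?A B))"
  proof (intro card_UN_disjoint ballI impI)
    fix B B' assume "B \<in> Bs" "B' \<in> Bs" "B \<noteq> B'"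
    then show "?A B \<inter> ?A B' = {}" using disj by fastforce
  qed (use Bs(1) finw in auto)
  also have "\<dots> = (\<Sum>B\<in>Bs. card (weighted_points p B (J B) n))"
    by (intro sum.cong refl card_image inj_on_subset[OF inj]) (auto simp: weighted_points_def)
  also have "\<dots> = (\<Sum>B\<in>Bs. \<Sum>k\<le>m. card (box_points p B (J B) k) * ((n + m - 1 - k) choose (m - 1)))"
  proof (intro sum.cong refl)
    fix B assume *: "B \<in> Bs"
    then have "card B = m" "finite B" "B \<noteq> {}" using B[OF *] Bs by auto
    then show "card (weighted_points p B (J B) n) =
        (\<Sum>k\<le>m. card (box_points p B (J B) k) * ((n + m - 1 - k) choose (m - 1)))"
      using card_weighted_points[of B n p "J B"] Bs p[OF *] finb[OF *] by simp
  qed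
  also have "\<dots> = (\<Sum>k\<le>m. \<Sum>B\<in>Bs. card (box_points p B (J B) k) * ((n + m - 1 - k) choose (m - 1)))"
    by (rule sum.swap)
  finally show ?thesis by (simp add: sum_distrib_right)
qed

section \<open>Ehrhart reciprocity\<close>

lemma box_points_cong: "J \<inter> B = J' \<inter> B \<Longrightarrow> box_points p B J k = box_points p B J' k"
  unfolding box_points_def weighted_points_def by blast

text \<open>At height 0 all weights vanish, which is allowed only when no facet is removed.\<close>

lemma card_box_points_0:
  assumes "finite B"
  shows "card (box_points p B J 0) = (if J \<inter> B = {} then 1 else 0)"
proof -
  have "box_points p B J 0 = (if J \<inter> B = {} then {restrict (\<lambda>_. 0) B} else {})"
    using assms
    by (auto simp: box_points_def weighted_points_def sum_nonneg_eq_0_iff integer_points_def extensional_def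
        split: if_splits)
  then show ?thesis by simp
qed

lemma sum_card_box_points_0:
  assumes "finite Bs" "\<And>B. B \<in> Bs \<Longrightarrow> basis B" "\<exists>!B. B \<in> Bs \<and> 0 \<in> halfopen_cone B q"
  shows "(\<Sum>B\<in>Bs. card (box_points p B {b. representation B q b < 0} 0)) = 1"
proof -
  obtain B0 where B0: "B0 \<in> Bs" "0 \<in> halfopen_cone B0 q" "\<And>B. B \<in> Bs \<Longrightarrow> 0 \<in> halfopen_cone B q \<Longrightarrow> B = B0"
    using assms(3) by blast
  have "card (box_points p B {b. representation B q b < 0} 0) = (if B = B0 then 1 else 0)" if "B \<in> Bs" for B
  proof -
    have "0 \<in> halfopen_cone B q \<longleftrightarrow> {b. representation B q b < 0} \<inter> B = {}"
      by (auto simp: halfopen_cone_def real_vector.representation_zero)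
    moreover have "0 \<in> halfopen_cone B q \<longleftrightarrow> B = B0" using B0 that by blast
    ultimately show ?thesis
      using card_box_points_0[OF basis_finite[OF assms(2)[OF that]], of p "{b. representation B q b < 0}"] by simp
  qed
  then show ?thesis using assms(1) B0(1) by simp
qed

lemma finite_regular_bases: "finite S \<Longrightarrow> finite (regular_bases S w)"
  by (rule finite_subset[of _ "Pow S"]) (auto simp: regular_bases_def)

lemma regular_basesD: "B \<in> regular_bases S w \<Longrightarrow> basis B \<and> B \<subseteq> S"
  by (simp add: regular_bases_def)

text \<open>\<open>P\<close> is placed at height 1 in one dimension more; \<open>(c, 1)\<close> is the direction of the decomposition.\<close>

locale full_polytope =
  fixes S :: "(real ^ 'n) set" and c :: "real ^ 'n"
  assumes fin: "finite S" and integral: "S \<subseteq> integer_points"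
    and c: "c \<in> interior (convex hull S)"
    and gen: "generic_point ((\<lambda>s. (s, 1 :: real)) ` S) (c, 1)"
begin

abbreviation "P \<equiv> convex hull S"
abbreviation "C \<equiv> (\<lambda>s. (s, 1 :: real)) ` S"

definition "cone_point v \<longleftrightarrow> (\<exists>l. (\<forall>s\<in>C. 0 \<le> l s) \<and> v = (\<Sum>s\<in>C. l s *\<^sub>R s))"

lemma c_in: "c \<in> P" using c interior_subset by blast

lemma sum_C: "(\<Sum>v\<in>C. l v *\<^sub>R v) = (\<Sum>s\<in>S. l (s, 1) *\<^sub>R s, \<Sum>s\<in>S. l (s, 1))"
proof -
  have "(\<Sum>v\<in>C. l v *\<^sub>R v) = (\<Sum>s\<in>S. l (s, 1) *\<^sub>R (s, 1))"
    by (subst sum.reindex) (auto simp: inj_on_def)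
  then show ?thesis by (simp add: prod_eq_iff fst_sum snd_sum)
qed

lemma cone_point_iff:
  assumes "0 < t"
  shows "cone_point (x, t) \<longleftrightarrow> (1 / t) *\<^sub>R x \<in> P"
proof
  assume "cone_point (x, t)"
  then obtain l where l: "\<forall>s\<in>C. 0 \<le> l s" "(x, t) = (\<Sum>s\<in>C. l s *\<^sub>R s)"
    by (auto simp: cone_point_def)
  then have x: "x = (\<Sum>s\<in>S. l (s, 1) *\<^sub>R s)" and t: "t = (\<Sum>s\<in>S. l (s, 1))"
    by (simp_all add: sum_C)
  have "(1 / t) *\<^sub>R x = (\<Sum>s\<in>S. (l (s, 1) / t) *\<^sub>R s)"
    unfolding x by (simp add: scaleR_sum_right)
  moreover have "(\<Sum>s\<in>S. l (s, 1) / t) = 1"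
    using t assms by (simp flip: sum_divide_distrib)
  ultimately show "(1 / t) *\<^sub>R x \<in> P"
    unfolding convex_hull_finite[OF fin] using l(1) assms
    by (intro CollectI exI[of _ "\<lambda>s. l (s, 1) / t"]) auto
next
  assume "(1 / t) *\<^sub>R x \<in> P"
  then obtain u where u: "\<forall>s\<in>S. 0 \<le> u s" "sum u S = 1" "(\<Sum>s\<in>S. u s *\<^sub>R s) = (1 / t) *\<^sub>R x"
    unfolding convex_hull_finite[OF fin] by blast
  have "x = t *\<^sub>R (\<Sum>s\<in>S. u s *\<^sub>R s)" using u(3) assms by simp
  then have "x = (\<Sum>s\<in>S. (t * u s) *\<^sub>R s)" by (simp add: scaleR_sum_right)
  moreover have "t = (\<Sum>s\<in>S. t * u s)" using u(2) by (simp flip: sum_distrib_left)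
  ultimately show "cone_point (x, t)"
    unfolding cone_point_def sum_C using u(1) assms
    by (intro exI[of _ "\<lambda>v. t * u (fst v)"]) auto
qed

lemma cone_point_add: "cone_point v \<Longrightarrow> cone_point w \<Longrightarrow> cone_point (v + w)"
  unfolding cone_point_def
proof clarify
  fix l l' :: "(real ^ 'n) \<times> real \<Rightarrow> real" assume "\<forall>s\<in>C. 0 \<le> l s" "\<forall>s\<in>C. 0 \<le> l' s"
  then show "\<exists>k. (\<forall>s\<in>C. 0 \<le> k s) \<and> (\<Sum>s\<in>C. l s *\<^sub>R s) + (\<Sum>s\<in>C. l' s *\<^sub>R s) = (\<Sum>s\<in>C. k s *\<^sub>R s)"
    by (intro exI[of _ "\<lambda>s. l s + l' s"]) (auto simp: scaleR_add_left sum.distrib)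
qed

lemma cone_point_scale: "cone_point v \<Longrightarrow> 0 \<le> t \<Longrightarrow> cone_point (t *\<^sub>R v)"
  unfolding cone_point_def
proof clarify
  fix l :: "(real ^ 'n) \<times> real \<Rightarrow> real" assume "\<forall>s\<in>C. 0 \<le> l s" "0 \<le> t"
  then show "\<exists>k. (\<forall>s\<in>C. 0 \<le> k s) \<and> t *\<^sub>R (\<Sum>s\<in>C. l s *\<^sub>R s) = (\<Sum>s\<in>C. k s *\<^sub>R s)"
    by (intro exI[of _ "\<lambda>s. t * l s"]) (auto simp: scaleR_sum_right)
qed

lemma cone_point_c: "cone_point (c, 1)"
  using cone_point_iff[of 1 c] c_in by simp

lemma cone_point_basis:
  assumes "basis B" "B \<subseteq> C" "\<forall>b\<in>B. 0 \<le> representation B v b"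
  shows "cone_point v"
  unfolding cone_point_def
proof (intro exI conjI)
  let ?l = "\<lambda>s. if s \<in> B then representation B v s else 0"
  show "\<forall>s\<in>C. 0 \<le> ?l s" using assms by auto
  have "v = (\<Sum>s\<in>B. representation B v s *\<^sub>R s)" using sum_representation[OF assms(1)] by simp
  also have "\<dots> = (\<Sum>s\<in>C. ?l s *\<^sub>R s)"
    using assms fin by (intro sum.mono_neutral_cong_left) auto
  finally show "v = (\<Sum>s\<in>C. ?l s *\<^sub>R s)" .
qed

lemma cone_point_eventually:
  assumes "0 < t" "(1 / t) *\<^sub>R x \<in> interior P"
  shows "\<forall>\<^sub>F e in at_right 0. cone_point ((x, t) + e *\<^sub>R (a, r))"
proof -
  have "((\<lambda>e. (1 / (t + e * r)) *\<^sub>R (x + e *\<^sub>R a)) \<longlongrightarrow> (1 / (t + 0 * r)) *\<^sub>R (x + 0 *\<^sub>R a)) (at_right 0)"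
    using assms(1) by (intro tendsto_intros) auto
  then have lim: "((\<lambda>e. (1 / (t + e * r)) *\<^sub>R (x + e *\<^sub>R a)) \<longlongrightarrow> (1 / t) *\<^sub>R x) (at_right 0)" by simp
  have "((\<lambda>e. t + e * r) \<longlongrightarrow> t + 0 * r) (at_right 0)" by (intro tendsto_intros)
  then have "\<forall>\<^sub>F e in at_right 0. 0 < t + e * r" using assms(1) by (intro order_tendstoD(1)) auto
  with topological_tendstoD[OF lim open_interior assms(2)]
  show ?thesis
  proof eventually_elim
    case (elim e)
    then have "(1 / (t + e * r)) *\<^sub>R (x + e *\<^sub>R a) \<in> P" using interior_subset by blast
    with elim(2) show ?case using cone_point_iff[of "t + e * r"] by simp
  qed
qed

text \<open>Every small displacement of \<open>(c, 1)\<close> stays in the cone, and differences of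
  cone points reach every direction.\<close>

lemma span_C: "span C = UNIV"
proof -
  have sp: "cone_point v \<Longrightarrow> v \<in> span C" for v
    by (auto simp: cone_point_def intro: span_sum span_scale span_base)
  have "v \<in> span C" for v
  proof -
    obtain a r where v: "v = (a, r)" by (cases v)
    obtain e where e: "0 < e" "cone_point ((c, 1) + e *\<^sub>R v)"
      using eventually_happens'[OF trivial_limit_at_right_real 
          eventually_conj[OF cone_point_eventually[of 1 c a r] eventually_at_right_less[of "0::real"]]] c v
      by auto
    have "v = (1 / e) *\<^sub>R (((c, 1) + e *\<^sub>R v) - (c, 1))" using e by simp
    also have "\<dots> \<in> span C" using sp e(2) cone_point_c by (intro span_scale span_diff) auto
    finally show ?thesis .
  qed
  then show ?thesis by auto
qed

lemma comb_eq:
  assumes "B \<subseteq> C"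
  shows "(\<Sum>b\<in>B. l b *\<^sub>R b) = (\<Sum>b\<in>B. l b *\<^sub>R fst b, sum l B)"
proof -
  have "snd b = 1" if "b \<in> B" for b using assms that by auto
  then show ?thesis by (simp add: prod_eq_iff fst_sum snd_sum)
qed

lemma fst_integral: "B \<subseteq> C \<Longrightarrow> b \<in> B \<Longrightarrow> fst b \<in> integer_points"
  using integral by fastforce

text \<open>All generators have last coordinate 1, so the coordinates of a point at height
  \<open>n\<close> sum to \<open>n\<close> and are its barycentric weights. The set \<open>A\<close>
  will be \<open>P\<close> and then its interior.\<close>

lemma count_cone:
  fixes q :: "(real ^ 'n) \<times> real"
  defines "J \<equiv> \<lambda>B. {b. representation B q b < 0}"
  assumes n: "0 < n"
    and ex: "\<And>z. (1 / real n) *\<^sub>R z \<in> A \<Longrightarrow> \<exists>!B. B \<in> regular_bases C w \<and> (z, real n) \<in> halfopen_cone B q"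
    and conv: "\<And>B z. B \<in> regular_bases C w \<Longrightarrow> (z, real n) \<in> halfopen_cone B q \<Longrightarrow> (1 / real n) *\<^sub>R z \<in> A"
  shows "card {z \<in> integer_points. (1 / real n) *\<^sub>R z \<in> A} =
    (\<Sum>k\<le>CARD('n) + 1. (\<Sum>B\<in>regular_bases C w. card (box_points fst B (J B) k)) *
      ((n + CARD('n) - k) choose CARD('n)))"
proof -
  let ?T = "regular_bases C w"
  note T = regular_basesD[of _ C w]
  have mem: "(\<Sum>b\<in>B. l b *\<^sub>R fst b, real n) \<in> halfopen_cone B q"
    if "B \<in> ?T" "l \<in> weighted_points fst B (J B) n" for B l
    using that T[OF that(1)] halfopen_cone_iff_sum[of B l q] comb_eq[of B l]
    by (auto simp: weighted_points_def J_def)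
  have "{z \<in> integer_points. (1 / real n) *\<^sub>R z \<in> A} =
      (\<Union>B\<in>?T. (\<lambda>l. \<Sum>b\<in>B. l b *\<^sub>R fst b) ` weighted_points fst B (J B) n)" (is "?L = ?R")
  proof (intro subset_antisym subsetI)
    fix z assume z: "z \<in> ?L"
    then obtain B where B: "B \<in> ?T" "(z, real n) \<in> halfopen_cone B q" using ex by blast
    define l where "l = restrict (representation B (z, real n)) B"
    have sum_l: "(\<Sum>b\<in>B. l b *\<^sub>R b) = (z, real n)"
      using sum_representation[of B "(z, real n)"] T[OF B(1)] by (simp add: l_def)
    then have "(\<Sum>b\<in>B. l b *\<^sub>R fst b) = z" "sum l B = real n"
      using comb_eq[of B l] T[OF B(1)] by auto
    moreover have "\<forall>b\<in>B. 0 \<le> l b \<and> (b \<in> J B \<longrightarrow> 0 < l b)"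
      using B(2) by (auto simp: halfopen_cone_def l_def J_def)
    ultimately have "l \<in> weighted_points fst B (J B) n" "z = (\<Sum>b\<in>B. l b *\<^sub>R fst b)"
      using z by (auto simp: weighted_points_def l_def)
    then show "z \<in> ?R" using B(1) by blast
  next
    fix z assume "z \<in> ?R"
    then obtain B l where *: "B \<in> ?T" "l \<in> weighted_points fst B (J B) n" "z = (\<Sum>b\<in>B. l b *\<^sub>R fst b)" by blast
    then show "z \<in> ?L" using conv[OF *(1)] mem[OF *(1,2)] by (auto simp: weighted_points_def)
  qed
  also have "card ?R = (\<Sum>k\<le>CARD('n) + 1. (\<Sum>B\<in>?T. card (box_points fst B (J B) k)) *
      ((n + (CARD('n) + 1) - 1 - k) choose (CARD('n) + 1 - 1)))"
  proof (rule card_UN_weighted_points)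
    show "finite ?T" using fin by (simp add: finite_regular_bases)
    show "finite B \<and> card B = CARD('n) + 1" if "B \<in> ?T" for B
      using T[OF that] basis_finite[of B] basis_card[of B] by simp
    show "fst b \<in> integer_points" if "B \<in> ?T" "b \<in> B" for B b
      using T[OF that(1)] that(2) by (intro fst_integral) auto
    show "inj_on (\<lambda>l. \<Sum>b\<in>B. l b *\<^sub>R fst b) {l \<in> extensional B. sum l B = real k}" if "B \<in> ?T" for B k
    proof (rule inj_onI, clarify)
      fix l l' assume "l \<in> extensional B" "l' \<in> extensional B" "sum l B = real k" "sum l' B = real k"
        "(\<Sum>b\<in>B. l b *\<^sub>R fst b) = (\<Sum>b\<in>B. l' b *\<^sub>R fst b)"
      then show "l = l'"
        using T[OF that] basis_combination_inj[of B l l'] comb_eq[of B l] comb_eq[of B l'] by simp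
    qed
    show "B = B'" if B: "B \<in> ?T" "B' \<in> ?T" and l: "l \<in> weighted_points fst B (J B) n"
      "l' \<in> weighted_points fst B' (J B') n" 
      and eq: "(\<Sum>b\<in>B. l b *\<^sub>R fst b) = (\<Sum>b\<in>B'. l' b *\<^sub>R fst b)" for B B' l l'
      using mem[OF B(1) l(1)] mem[OF B(2) l(2)] eq ex[OF conv[OF B(1) mem[OF B(1) l(1)]]] B by auto
  qed (use n in auto)
  finally show ?thesis by simp
qed

text \<open>One triangulation is used with two directions: \<open>(c, 1)\<close> points into the
  cone and keeps all of \<open>P\<close>, its negative keeps only the interior. On each simplex the
  reversal complements the set of removed facets, which reverses the heights of the box
  points.\<close>

lemma ehrhart_reciprocity:
  "\<exists>h :: nat \<Rightarrow> nat. h 0 = 1 \<and> h (CARD('n) + 1) = 0 \<and> (\<forall>n>0.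
    card {z \<in> integer_points. (1 / real n) *\<^sub>R z \<in> P} =
      (\<Sum>k\<le>CARD('n) + 1. h k * ((n + CARD('n) - k) choose CARD('n))) \<and>
    card {z \<in> integer_points. (1 / real n) *\<^sub>R z \<in> interior P} =
      (\<Sum>k\<le>CARD('n) + 1. h (CARD('n) + 1 - k) * ((n + CARD('n) - k) choose CARD('n))))"
proof -
  have finC: "finite C" using fin by simp
  obtain w where w: "generic_weight C w" "\<forall>s\<in>C. 0 < w s"
    using generic_weight_near_one[OF finC] by blast
  let ?T = "regular_bases C w" and ?q = "(c, 1 :: real)"
  note T = regular_basesD[of _ C w]
  have gen': "generic_point C (- ?q)"
    using gen by (auto simp: generic_point_def representation_uminus simp del: uminus_Pair)
  have deco: "\<exists>!B. B \<in> ?T \<and> v \<in> halfopen_cone B q"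
    if "generic_point C q" "\<forall>\<^sub>F t in at_right 0. cone_point (v + t *\<^sub>R q)" for v q
    using halfopen_decomposition[OF finC span_C w that(1), of v] that(2) by (simp add: cone_point_def)
  have ex: "\<exists>!B. B \<in> ?T \<and> v \<in> halfopen_cone B ?q" if "cone_point v" for v
    using that cone_point_c
    by (intro deco gen eventually_at_right_0I[of 1] cone_point_add cone_point_scale) auto
  define J where "J B = {b. representation B ?q b < 0}" for B
  define J' where "J' B = {b. representation B (- ?q) b < 0}" for B
  define h where "h k = (\<Sum>B\<in>?T. card (box_points fst B (J B) k))" for k
  have "cone_point 0" by (auto simp: cone_point_def intro!: exI[of _ "\<lambda>_. 0"])
  then have "h 0 = 1"
    unfolding h_def J_def using ex T finC
    by (intro sum_card_box_points_0) (auto simp: finite_regular_bases)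
  moreover have "h (CARD('n) + 1) = 0"
  proof -
    \<comment> \<open>At this height all weights equal 1, so every facet would be removed and all
      coordinates of \<open>(c, 1)\<close> would be negative; but they sum to 1.\<close>
    have "box_points fst B (J B) (CARD('n) + 1) = {}" if B: "B \<in> ?T" for B
    proof (rule ccontr)
      have bas: "basis B" "B \<subseteq> C" using T[OF B] by auto
      assume "\<not> ?thesis"
      then obtain l where l: "l \<in> box_points fst B (J B) (CARD('n) + 1)" by blast
      have "sum l B = real (card B)" using l basis_card[OF bas(1)] by (simp add: box_points_def weighted_points_def)
      then have "(\<Sum>b\<in>B. 1 - l b) = 0" by (simp add: sum_subtractf)
      moreover have "\<forall>b\<in>B. 0 \<le> 1 - l b" using l by (auto simp: box_points_def)
      ultimately have "\<forall>b\<in>B. 1 - l b = 0"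
        using sum_nonneg_eq_0_iff[of B "\<lambda>b. 1 - l b"] basis_finite[OF bas(1)] by simp
      then have "\<forall>b\<in>B. b \<in> J B" using l by (force simp: box_points_def)
      then have "(\<Sum>b\<in>B. representation B ?q b) \<le> 0"
        by (intro sum_nonpos) (auto simp: J_def)
      moreover have "(\<Sum>b\<in>B. representation B ?q b) = 1"
        using sum_representation[OF bas(1), of ?q] comb_eq[OF bas(2), of "representation B ?q"] by simp
      ultimately show False by simp
    qed
    then show ?thesis by (simp add: h_def)
  qed
  moreover have "card {z \<in> integer_points. (1 / real n) *\<^sub>R z \<in> P} =
      (\<Sum>k\<le>CARD('n) + 1. h k * ((n + CARD('n) - k) choose CARD('n)))" if n: "0 < n" for n
    unfolding h_def J_def
  proof (rule count_cone[OF n])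
    show "\<exists>!B. B \<in> ?T \<and> (z, real n) \<in> halfopen_cone B ?q" if "(1 / real n) *\<^sub>R z \<in> P" for z
      using ex cone_point_iff[of "real n" z] that n by simp
    show "(1 / real n) *\<^sub>R z \<in> P" if "B \<in> ?T" "(z, real n) \<in> halfopen_cone B ?q" for B z
      using cone_point_basis[of B "(z, real n)"] T[OF that(1)] that(2) n cone_point_iff[of "real n" z]
      by (auto simp: halfopen_cone_def)
  qed
  moreover have "card {z \<in> integer_points. (1 / real n) *\<^sub>R z \<in> interior P} =
      (\<Sum>k\<le>CARD('n) + 1. h (CARD('n) + 1 - k) * ((n + CARD('n) - k) choose CARD('n)))" if n: "0 < n" for n
  proof -
    have "card {z \<in> integer_points. (1 / real n) *\<^sub>R z \<in> interior P} =
      (\<Sum>k\<le>CARD('n) + 1. (\<Sum>B\<in>?T. card (box_points fst B (J' B) k)) * ((n + CARD('n) - k) choose CARD('n)))"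
      unfolding J'_def
    proof (rule count_cone[OF n])
      show "\<exists>!B. B \<in> ?T \<and> (z, real n) \<in> halfopen_cone B (- ?q)" if "(1 / real n) *\<^sub>R z \<in> interior P" for z
        using cone_point_eventually[of "real n" z "- c" "- 1"] that n by (intro deco gen') simp_all
      show "(1 / real n) *\<^sub>R z \<in> interior P" if B: "B \<in> ?T" and z: "(z, real n) \<in> halfopen_cone B (- ?q)" for B z
      proof -
        have bas: "basis B" "B \<subseteq> C" using T[OF B] by auto
        have gB: "\<forall>b\<in>B. representation B (- ?q) b \<noteq> 0"
          using gen' bas unfolding generic_point_def by blast
        have "\<forall>\<^sub>F t in at_right 0. \<forall>b\<in>B. 0 < representation B ((z, real n) + t *\<^sub>R (- ?q)) b"
          using z halfopen_cone_iff[OF bas(1) gB] by blast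
        moreover have "\<forall>\<^sub>F t in at_right 0. (0::real) < t \<and> t < real n"
          using n by (intro eventually_at_right_0I[of "real n"]) auto
        ultimately have "\<forall>\<^sub>F t in at_right 0. cone_point ((z, real n) + t *\<^sub>R (- ?q)) \<and> 0 < t \<and> t < real n"
          by eventually_elim (use cone_point_basis[OF bas] in \<open>auto simp: less_imp_le simp del: uminus_Pair\<close>)
        then obtain t where t: "cone_point ((z, real n) + t *\<^sub>R (- ?q))" "0 < t" "t < real n"
          using eventually_happens'[OF trivial_limit_at_right_real] by blast
        then have y: "(1 / (real n - t)) *\<^sub>R (z - t *\<^sub>R c) \<in> P" (is "?y \<in> P")
          using cone_point_iff[of "real n - t" "z - t *\<^sub>R c"] by simp
        \<comment> \<open>The point \<open>z / n\<close> is a convex combination of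
          \<open>?y\<close> in \<open>P\<close> and the interior point \<open>c\<close>, with weight
          \<open>t / n > 0\<close> on \<open>c\<close>.\<close>
        have "?y - (t / real n) *\<^sub>R (?y - c) \<in> interior P"
          using t n c y by (intro mem_interior_convex_shrink) auto
        also have "?y - (t / real n) *\<^sub>R (?y - c) = (1 - t / real n) *\<^sub>R ?y + (t / real n) *\<^sub>R c"
          unfolding scaleR_diff_left scaleR_diff_right by simp
        also have "(1 - t / real n) *\<^sub>R ?y = (1 / real n) *\<^sub>R (z - t *\<^sub>R c)"
        proof -
          have "(1 - t / real n) * (1 / (real n - t)) = 1 / real n"
            using t n by (simp add: field_simps)
          then show ?thesis by (simp only: scaleR_scaleR)
        qed
        also have "(1 / real n) *\<^sub>R (z - t *\<^sub>R c) + (t / real n) *\<^sub>R c = (1 / real n) *\<^sub>R z"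
          by (simp add: scaleR_diff_right)
        finally show ?thesis .
      qed
    qed
    also have "\<dots> = (\<Sum>k\<le>CARD('n) + 1. h (CARD('n) + 1 - k) * ((n + CARD('n) - k) choose CARD('n)))"
    proof (intro sum.cong refl arg_cong2[where f = "(*)"])
      fix k assume k: "k \<in> {..CARD('n) + 1}"
      have "card (box_points fst B (J' B) k) = card (box_points fst B (J B) (CARD('n) + 1 - k))" if B: "B \<in> ?T" for B
      proof -
        have bas: "basis B" "B \<subseteq> C" using T[OF B] by auto
        have "representation B ?q b \<noteq> 0" if "b \<in> B" for b
          using gen bas that unfolding generic_point_def by blast
        moreover have "representation B (- ?q) b = - representation B ?q b" for b
          by (rule representation_uminus[OF bas(1)])
        ultimately have "J' B \<inter> B = (B - J B) \<inter> B"
          unfolding J_def J'_def by (auto simp: not_less order_less_le simp del: uminus_Pair)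
        then have "box_points fst B (J' B) k = box_points fst B (B - J B) k" by (rule box_points_cong)
        moreover have "card B = CARD('n) + 1" using basis_card[OF bas(1)] by simp
        moreover have "fst b \<in> integer_points" if "b \<in> B" for b using fst_integral[OF bas(2) that] .
        ultimately show ?thesis
          using card_box_points_reflect[of B k fst "J B"] basis_finite[OF bas(1)] k by simp
      qed
      then show "(\<Sum>B\<in>?T. card (box_points fst B (J' B) k)) = h (CARD('n) + 1 - k)"
        by (simp add: h_def)
    qed
    finally show ?thesis .
  qed
  ultimately show ?thesis by blast
qed

end

section \<open>The boundary\<close>

context full_polytope begin

abbreviation "V \<equiv> (\<lambda>s. s - c) ` S"

lemma sum_V: "(\<Sum>v\<in>V. l v *\<^sub>R v) = (\<Sum>s\<in>S. l (s - c) *\<^sub>R (s - c))"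
  by (subst sum.reindex) (auto simp: inj_on_def)

text \<open>The fan is complete: from the interior point \<open>c\<close> a small step along any
  \<open>y\<close> stays in \<open>P\<close>.\<close>

lemma nonneg_combination_V: "\<exists>l. (\<forall>v\<in>V. 0 \<le> l v) \<and> y = (\<Sum>v\<in>V. l v *\<^sub>R v)"
proof -
  have "((\<lambda>e. c + e *\<^sub>R y) \<longlongrightarrow> c + 0 *\<^sub>R y) (at_right 0)" by (intro tendsto_intros)
  then have "\<forall>\<^sub>F e in at_right 0. c + e *\<^sub>R y \<in> interior P"
    using c by (intro topological_tendstoD) auto
  then obtain e where e: "0 < e" "c + e *\<^sub>R y \<in> interior P"
    using eventually_happens'[OF trivial_limit_at_right_real
        eventually_conj[OF _ eventually_at_right_less[of "0::real"]]] by blast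
  then have "c + e *\<^sub>R y \<in> P" using interior_subset by blast
  then obtain u where u: "\<forall>s\<in>S. 0 \<le> u s" "sum u S = 1" "(\<Sum>s\<in>S. u s *\<^sub>R s) = c + e *\<^sub>R y"
    unfolding convex_hull_finite[OF fin] by blast
  have "e *\<^sub>R y = (\<Sum>s\<in>S. u s *\<^sub>R (s - c))"
    using u(2,3) by (simp add: scaleR_diff_right sum_subtractf flip: scaleR_sum_left)
  then have "y = (1 / e) *\<^sub>R (\<Sum>s\<in>S. u s *\<^sub>R (s - c))" using e(1) by (metis divide_self_if less_irrefl scaleR_one scaleR_scaleR times_divide_eq_left mult_1)
  then have "y = (\<Sum>s\<in>S. (u s / e) *\<^sub>R (s - c))" by (simp add: scaleR_sum_right)
  then show ?thesis
    unfolding sum_V using u(1) e(1) by (intro exI[of _ "\<lambda>v. u (v + c) / e"]) auto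
qed

lemma span_V: "span V = UNIV"
proof -
  have "y \<in> span V" for y
  proof -
    obtain l where "y = (\<Sum>v\<in>V. l v *\<^sub>R v)" using nonneg_combination_V[of y] by blast
    then show ?thesis by (auto intro: span_sum span_scale span_base)
  qed
  then show ?thesis by auto
qed

text \<open>
  The fan is spanned by the vectors \<open>s - c\<close>. As the weights are close to 1, each regular basis \<open>B\<close> lies on
  a face of \<open>P\<close>: the functional that is 1 on \<open>B\<close> is at most 1 on all \<open>s - c\<close>.
\<close>

lemma boundary_count:
  assumes k: "k \<le> CARD('n)"
  shows "\<exists>a :: nat \<Rightarrow> nat. a 0 = 1 \<and> 1 \<le> a k \<and> (\<forall>n>0.
    card {z \<in> integer_points. (1 / real n) *\<^sub>R z \<in> P - interior P} =
      (\<Sum>i\<le>CARD('n). a i * ((n + CARD('n) - 1 - i) choose (CARD('n) - 1))))"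
proof -
  have finV: "finite V" using fin by simp
  obtain w where w: "generic_weight V w" "\<forall>s\<in>V. 0 < w s"
      "\<forall>B\<in>regular_bases V w. \<forall>s\<in>V. (\<Sum>b\<in>B. representation B s b) \<le> 1"
    using generic_weight_near_one[OF finV] by blast
  let ?T = "regular_bases V w"
  note T = regular_basesD[of _ V w]
  have deco: "\<exists>!B. B \<in> ?T \<and> v \<in> halfopen_cone B q" if "generic_point V q" for v q
    by (rule halfopen_decomposition[OF finV span_V w(1,2) that])
       (intro always_eventually allI nonneg_combination_V)
  obtain B0 where B0: "B0 \<in> ?T"
    using generic_point_exists[OF finV, of UNIV] deco by blast
  have bas0: "basis B0" using T[OF B0] by simp
  obtain K where K: "K \<subseteq> B0" "card K = k"
    using obtain_subset_with_card_n[of k B0] k basis_card[OF bas0] by auto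
  have finB0: "finite B0" by (rule basis_finite[OF bas0])
  \<comment> \<open>The directions whose negative coordinates at \<open>B0\<close> are exactly those
    in \<open>K\<close>: a nonempty open set, so it contains a generic direction.\<close>
  define U where "U = (\<Inter>b\<in>B0. {x. if b \<in> K then representation B0 x b < 0 else 0 < representation B0 x b})"
  have "open U"
  proof -
    have "continuous_on UNIV (\<lambda>x. representation B0 x b)" for b
      using bas0 by (intro linear_continuous_on bounded_linear_representation) (auto simp: basis_def)
    then have "open {x. if b \<in> K then representation B0 x b < 0 else 0 < representation B0 x b}" for b
      by (cases "b \<in> K") (auto intro!: open_Collect_less)
    then show ?thesis unfolding U_def using finB0 by (intro open_INT) auto
  qed
  moreover have "(\<Sum>b\<in>B0. (if b \<in> K then - 1 else 1) *\<^sub>R b) \<in> U"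
    by (auto simp: U_def representation_unique[OF bas0])
  ultimately obtain u where u: "u \<in> U" "generic_point V u"
    using generic_point_exists[OF finV, of U] by blast
  define J where "J B = {b. representation B u b < 0}" for B
  \<comment> \<open>Back from the fan's generators to the lattice vertices of
    \<open>P\<close>.\<close>
  define p where "p b = b + c" for b
  define a where "a i = (\<Sum>B\<in>?T. card (box_points p B (J B) i))" for i
  have p_S: "p b \<in> S" if "B \<in> ?T" "b \<in> B" for B b
    using T[OF that(1)] that(2) by (auto simp: p_def)
  have comb: "(\<Sum>b\<in>B. l b *\<^sub>R p b) = (\<Sum>b\<in>B. l b *\<^sub>R b) + sum l B *\<^sub>R c" for l and B :: "(real ^ 'n) set"
    by (simp add: p_def scaleR_add_right sum.distrib scaleR_sum_left)
  have finw: "finite (weighted_points p B I n)" and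
    inj: "inj_on (\<lambda>l. \<Sum>b\<in>B. l b *\<^sub>R p b) {l \<in> extensional B. sum l B = real n}"
    if "B \<in> ?T" for B I n
  proof -
    have bas: "basis B" using T[OF that] by simp
    show inj: "inj_on (\<lambda>l. \<Sum>b\<in>B. l b *\<^sub>R p b) {l \<in> extensional B. sum l B = real n}"
      unfolding comb by (rule inj_onI) (auto intro: basis_combination_inj[OF bas])
    show "finite (weighted_points p B I n)"
      by (rule finite_weighted_points[OF basis_finite[OF bas] inj])
  qed
  have "a 0 = 1"
    unfolding a_def J_def using deco[OF u(2)] T finV
    by (intro sum_card_box_points_0) (auto simp: finite_regular_bases)
  moreover have "1 \<le> a k"
  proof -
    \<comment> \<open>The sum of the vertices in \<open>K\<close> is a box point at height
      \<open>k\<close>: weight 1 is allowed on \<open>J B0\<close>, weight 0 outside it, and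
      \<open>J B0\<close> meets \<open>B0\<close> in \<open>K\<close>.\<close>
    let ?l = "restrict (\<lambda>b. if b \<in> K then 1 else 0) B0"
    have JK: "b \<in> J B0 \<longleftrightarrow> b \<in> K" if "b \<in> B0" for b
      using u(1) that by (auto simp: U_def J_def split: if_splits)
    have eq: "(\<Sum>b\<in>B0. ?l b *\<^sub>R p b) = (\<Sum>b\<in>B0. real (if b \<in> K then 1 else 0) *\<^sub>R p b)"
      by (intro sum.cong) auto
    have "(\<Sum>b\<in>B0. ?l b *\<^sub>R p b) \<in> integer_points"
      unfolding eq using p_S[OF B0] integral by (intro integer_points_sum) auto
    moreover have "sum ?l B0 = real k"
    proof -
      have "sum ?l B0 = (\<Sum>b\<in>B0. if b \<in> K then 1 else 0)" by (intro sum.cong) auto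
      also have "\<dots> = real (card (B0 \<inter> K))"
        using finB0 by (simp add: sum.If_cases) 
      finally show ?thesis using K by (simp add: Int_absorb1)
    qed
    ultimately have "?l \<in> box_points p B0 (J B0) k"
      using JK by (auto simp: box_points_def weighted_points_def)
    moreover have "finite (box_points p B0 (J B0) k)"
      using finw[OF B0] by (rule finite_subset[rotated]) (auto simp: box_points_def)
    ultimately have "1 \<le> card (box_points p B0 (J B0) k)"
      by (metis One_nat_def Suc_leI card_gt_0_iff empty_iff)
    also have "\<dots> \<le> a k"
      unfolding a_def using B0 finV by (intro member_le_sum) (auto simp: finite_regular_bases)
    finally show ?thesis .
  qed
  moreover have "card {z \<in> integer_points. (1 / real n) *\<^sub>R z \<in> P - interior P} =
      (\<Sum>i\<le>CARD('n). a i * ((n + CARD('n) - 1 - i) choose (CARD('n) - 1)))" if n: "0 < n" for n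
  proof -
    have mem: "(\<Sum>b\<in>B. l b *\<^sub>R p b) - real n *\<^sub>R c \<in> halfopen_cone B u"
      if "B \<in> ?T" "l \<in> weighted_points p B (J B) n" for B l
      using that T[OF that(1)] halfopen_cone_iff_sum[of B l u]
      by (auto simp: weighted_points_def J_def comb)
    have phi: "(\<Sum>b\<in>B. representation B (x - c) b) \<le> 1" if B: "B \<in> ?T" and x: "x \<in> P" for B x
    proof -
      obtain v where v: "\<forall>s\<in>S. 0 \<le> v s" "sum v S = 1" "(\<Sum>s\<in>S. v s *\<^sub>R s) = x"
        using x unfolding convex_hull_finite[OF fin] by blast
      have "x - c = (\<Sum>s\<in>S. v s *\<^sub>R (s - c))"
        using v(2,3) by (simp add: scaleR_diff_right sum_subtractf flip: scaleR_sum_left)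
      then have "(\<Sum>b\<in>B. representation B (x - c) b) = (\<Sum>b\<in>B. \<Sum>s\<in>S. v s * representation B (s - c) b)"
        using T[OF B] by (simp add: representation_sum_scale)
      also have "\<dots> = (\<Sum>s\<in>S. v s * (\<Sum>b\<in>B. representation B (s - c) b))"
        by (subst sum.swap) (simp add: sum_distrib_left)
      also have "\<dots> \<le> (\<Sum>s\<in>S. v s * 1)"
        using w(3) B v(1) by (intro sum_mono mult_left_mono) auto
      finally show ?thesis using v(2) by simp
    qed
    have "{z \<in> integer_points. (1 / real n) *\<^sub>R z \<in> P - interior P} =
        (\<Union>B\<in>?T. (\<lambda>l. \<Sum>b\<in>B. l b *\<^sub>R p b) ` weighted_points p B (J B) n)" (is "?L = ?R")
    proof (intro subset_antisym subsetI)
      fix z assume z: "z \<in> ?L"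
      let ?y = "z - real n *\<^sub>R c" and ?x = "(1 / real n) *\<^sub>R z"
      obtain B where B: "B \<in> ?T" "?y \<in> halfopen_cone B u" using deco[OF u(2)] by blast
      have bas: "basis B" using T[OF B(1)] by simp
      define l where "l = restrict (representation B ?y) B"
      have y: "(\<Sum>b\<in>B. l b *\<^sub>R b) = ?y"
        using sum_representation[OF bas, of ?y] by (simp add: l_def)
      have l0: "\<forall>b\<in>B. 0 \<le> l b \<and> (b \<in> J B \<longrightarrow> 0 < l b)"
        using B(2) by (auto simp: halfopen_cone_def l_def J_def)
      have y_scale: "?y = 0 + real n *\<^sub>R (?x - c)" using n by (simp add: scaleR_diff_right)
      have "sum l B = real n * (\<Sum>b\<in>B. representation B (?x - c) b)"
        unfolding l_def y_scale representation_line[OF bas]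
        by (simp add: sum_distrib_left real_vector.representation_zero)
      also have "\<dots> \<le> real n * 1"
        using phi[OF B(1), of ?x] z by (intro mult_left_mono) auto
      finally have le: "sum l B \<le> real n" by simp
      \<comment> \<open>Otherwise \<open>z / n\<close> would be \<open>c\<close>, or a proper convex
        combination of \<open>c\<close> and a point \<open>x'\<close> of \<open>P\<close>, and so
        interior.\<close>
      have "sum l B = real n"
      proof (rule ccontr)
        assume "sum l B \<noteq> real n"
        with le have less: "sum l B < real n" by simp
        have zc: "z = (\<Sum>b\<in>B. l b *\<^sub>R b) + real n *\<^sub>R c" by (simp add: y)
        have "?x \<in> interior P"
        proof (cases "sum l B = 0")
          case True
          then have "\<forall>b\<in>B. l b = 0" using l0 basis_finite[OF bas] by (simp add: sum_nonneg_eq_0_iff)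
          then have "z = real n *\<^sub>R c" unfolding zc by simp
          then show ?thesis using c n by simp
        next
          case False
          then have pos: "0 < sum l B" using l0 by (simp add: sum_nonneg order_less_le)
          define s where "s = sum l B"
          have s: "0 < s" "s < real n" using pos less by (auto simp: s_def)
          define x' where "x' = (\<Sum>b\<in>B. (l b / s) *\<^sub>R p b)"
          have "x' \<in> P"
            unfolding x'_def
          proof (rule convex_sum)
            show "(\<Sum>b\<in>B. l b / s) = 1" using s by (simp add: s_def flip: sum_divide_distrib)
            show "p b \<in> P" if "b \<in> B" for b using p_S[OF B(1) that] by (rule hull_inc)
          qed (use l0 s basis_finite[OF bas] in auto)
          then have "x' - (1 - s / real n) *\<^sub>R (x' - c) \<in> interior P"
            using s n c by (intro mem_interior_convex_shrink) auto
          also have "x' - (1 - s / real n) *\<^sub>R (x' - c) = (1 / real n) *\<^sub>R (s *\<^sub>R x' + (real n - s) *\<^sub>R c)"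
            using n unfolding scaleR_diff_left scaleR_diff_right scaleR_add_right by simp
          also have "s *\<^sub>R x' = (\<Sum>b\<in>B. l b *\<^sub>R b) + s *\<^sub>R c"
            using s comb[of l B] by (simp add: x'_def scaleR_sum_right s_def)
          also have "(\<Sum>b\<in>B. l b *\<^sub>R b) + s *\<^sub>R c + (real n - s) *\<^sub>R c = z"
            unfolding scaleR_diff_left by (simp add: y)
          finally show ?thesis .
        qed
        with z show False by simp
      qed
      then have "l \<in> weighted_points p B (J B) n" "z = (\<Sum>b\<in>B. l b *\<^sub>R p b)"
        using z l0 y comb[of l B] by (auto simp: weighted_points_def l_def)
      then show "z \<in> ?R" using B(1) by blast
    next
      fix z assume "z \<in> ?R"
      then obtain B l where B: "B \<in> ?T" and l: "l \<in> weighted_points p B (J B) n"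
        and z: "z = (\<Sum>b\<in>B. l b *\<^sub>R p b)" by blast
      have bas: "basis B" using T[OF B] by simp
      let ?x = "(1 / real n) *\<^sub>R z"
      have x: "?x = (\<Sum>b\<in>B. (l b / real n) *\<^sub>R p b)" by (simp add: z scaleR_sum_right)
      have "?x \<in> P"
        unfolding x
      proof (rule convex_sum)
        show "(\<Sum>b\<in>B. l b / real n) = 1"
          using l n by (simp add: weighted_points_def flip: sum_divide_distrib)
        show "p b \<in> P" if "b \<in> B" for b using p_S[OF B that] by (rule hull_inc)
      qed (use l n basis_finite[OF bas] in \<open>auto simp: weighted_points_def\<close>)
      moreover have "?x \<notin> interior P"
      proof
        assume int: "?x \<in> interior P"
        have "?x - c = (1 / real n) *\<^sub>R (\<Sum>b\<in>B. l b *\<^sub>R b)"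
          using l n by (simp add: z comb weighted_points_def scaleR_add_right)
        then have "?x - c = (\<Sum>b\<in>B. (l b / real n) *\<^sub>R b)" by (simp add: scaleR_sum_right)
        then have "(\<Sum>b\<in>B. representation B (?x - c) b) = (\<Sum>b\<in>B. l b / real n)"
          using representation_unique[OF bas, of _ "\<lambda>b. l b / real n"] by (intro sum.cong) auto
        also have "\<dots> = 1" using l n by (simp add: weighted_points_def flip: sum_divide_distrib)
        finally have one: "(\<Sum>b\<in>B. representation B (?x - c) b) = 1" .
        \<comment> \<open>If \<open>?x\<close> were interior, one could move on from
          \<open>c\<close> through \<open>?x\<close> within \<open>P\<close>, and the functional
          that is 1 at \<open>?x\<close> would exceed its bound 1 from \<open>phi\<close>.\<close>
        have "((\<lambda>e. ?x + e *\<^sub>R (?x - c)) \<longlongrightarrow> ?x + 0 *\<^sub>R (?x - c)) (at_right 0)" by (intro tendsto_intros)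
        then have "\<forall>\<^sub>F e in at_right 0. ?x + e *\<^sub>R (?x - c) \<in> interior P"
          using int by (intro topological_tendstoD) auto
        then obtain e where e: "0 < e" "?x + e *\<^sub>R (?x - c) \<in> interior P"
          using eventually_happens'[OF trivial_limit_at_right_real
              eventually_conj[OF _ eventually_at_right_less[of "0::real"]]] by blast
        then have "(\<Sum>b\<in>B. representation B (?x + e *\<^sub>R (?x - c) - c) b) \<le> 1"
          using interior_subset by (intro phi[OF B]) blast
        moreover have "?x + e *\<^sub>R (?x - c) - c = (?x - c) + e *\<^sub>R (?x - c)" by simp
        ultimately have "(\<Sum>b\<in>B. representation B ((?x - c) + e *\<^sub>R (?x - c)) b) \<le> 1" by (simp only:)
        then have "1 + e * 1 \<le> 1"
          unfolding representation_line[OF bas] sum.distrib sum_distrib_left[symmetric] one .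
        with e(1) show False by simp
      qed
      ultimately show "z \<in> ?L" using l by (simp add: z weighted_points_def)
    qed
    also have "card ?R = (\<Sum>k\<le>CARD('n). (\<Sum>B\<in>?T. card (box_points p B (J B) k)) *
        ((n + CARD('n) - 1 - k) choose (CARD('n) - 1)))"
    proof (rule card_UN_weighted_points)
      show "finite ?T" using finV by (simp add: finite_regular_bases)
      show "finite B \<and> card B = CARD('n)" if "B \<in> ?T" for B
        using T[OF that] basis_finite[of B] basis_card[of B] by simp
      show "p b \<in> integer_points" if "B \<in> ?T" "b \<in> B" for B b
        using p_S[OF that] integral by blast
      show "B = B'" if B: "B \<in> ?T" "B' \<in> ?T" and l: "l \<in> weighted_points p B (J B) n"
        "l' \<in> weighted_points p B' (J B') n"
        and eq: "(\<Sum>b\<in>B. l b *\<^sub>R p b) = (\<Sum>b\<in>B'. l' b *\<^sub>R p b)" for B B' l l'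
        using mem[OF B(1) l(1)] mem[OF B(2) l(2)] eq deco[OF u(2)] B by auto
    qed (use n inj in auto)
    finally show ?thesis by (simp only: a_def)
  qed
  ultimately show ?thesis by blast
qed

end

section \<open>Linear inequalities up to dimension 13\<close>

text \<open>Summation by parts. Keeping the term \<open>Y m\<close> on the left makes the induction
  work without a sign condition on \<open>Y\<close>.\<close>

lemma abel_lower_bound:
  fixes x Y :: "nat \<Rightarrow> real"
  assumes anti: "\<And>j. 1 \<le> j \<Longrightarrow> j < m \<Longrightarrow> Y (Suc j) \<le> Y j" and m: "1 \<le> m"
    and part: "\<And>r. 1 \<le> r \<Longrightarrow> r \<le> m \<Longrightarrow> 0 \<le> (\<Sum>j=1..r. x j)"
  shows "Y m * (\<Sum>j=1..m. x j) \<le> (\<Sum>j=1..m. Y j * x j)"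
  using m anti part
proof (induction m rule: nat_induct_at_least)
  case (Suc m)
  have "Y (Suc m) * (\<Sum>j=1..m. x j) \<le> Y m * (\<Sum>j=1..m. x j)"
    using Suc.prems Suc.hyps by (intro mult_right_mono) auto
  also have "\<dots> \<le> (\<Sum>j=1..m. Y j * x j)" using Suc by auto
  finally show ?case by (simp add: distrib_left)
qed simp

text \<open>Pairs \<open>j\<close> with \<open>d + 1 - j\<close>. Index 0 has its partner outside
  the range, and for odd \<open>d\<close> the middle index is its own partner.\<close>

lemma half_sum_split:
  fixes f :: "nat \<Rightarrow> real"
  shows "(\<Sum>k\<le>d. f k) = f 0 + (\<Sum>j=1..d div 2. f j + f (d + 1 - j)) +
    (if odd d then f ((d + 1) div 2) else 0)"
proof -
  have A: "{..d} = {0} \<union> {1..d div 2} \<union> (if odd d then {(d + 1) div 2} else {}) \<union> {d + 1 - d div 2..d}"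
    by (auto elim!: oddE)
  have "(\<Sum>j=d + 1 - d div 2..d. f j) = (\<Sum>j=1..d div 2. f (d + 1 - j))"
    by (rule sum.reindex_bij_witness[of _ "\<lambda>j. d + 1 - j" "\<lambda>j. d + 1 - j"]) auto
  moreover have "(\<Sum>k\<le>d. f k) = (\<Sum>j\<in>{0} \<union> {1..d div 2} \<union> (if odd d then {(d + 1) div 2} else {}). f j) +
      (\<Sum>j=d + 1 - d div 2..d. f j)"
    unfolding A by (rule sum.union_disjoint) (auto elim!: oddE)
  moreover have "(\<Sum>j\<in>{0} \<union> {1..d div 2} \<union> (if odd d then {(d + 1) div 2} else {}). f j) =
      (\<Sum>j\<in>{0} \<union> {1..d div 2}. f j) + (\<Sum>j\<in>(if odd d then {(d + 1) div 2} else {}). f j)"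
    by (rule sum.union_disjoint) (auto elim!: oddE)
  moreover have "(\<Sum>j\<in>{0} \<union> {1..d div 2}. f j) = f 0 + (\<Sum>j=1..d div 2. f j)"
    by (subst sum.union_disjoint) auto
  ultimately show ?thesis by (simp add: sum.distrib)
qed

text \<open>A Farkas argument: the form is bounded by minus a combination of the inequalities
  \<open>hibi\<close> with non-negative multipliers, the successive differences of a decreasing
  sequence \<open>Y\<close> and its last value.\<close>

lemma linear_form_nonpos:
  fixes h e :: "nat \<Rightarrow> real"
  assumes h: "\<And>k. k \<le> d \<Longrightarrow> 0 \<le> h k"
    and hibi: "\<And>r. 1 \<le> r \<Longrightarrow> r \<le> d div 2 \<Longrightarrow> 0 \<le> (\<Sum>j=1..r. h j - h (d + 1 - j))"
    and e1: "\<And>j. j \<le> (d + 1) div 2 \<Longrightarrow> e j \<le> 0"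
    and e2: "\<And>j r. 1 \<le> j \<Longrightarrow> j \<le> r \<Longrightarrow> r \<le> d div 2 \<Longrightarrow> e j + e (d + 1 - r) \<le> 0"
  shows "(\<Sum>k\<le>d. e k * h k) \<le> 0"
proof -
  let ?m = "d div 2"
  \<comment> \<open>The prefix minimum is decreasing by construction and satisfies
    \<open>e (d + 1 - j) \<le> Y j \<le> - e j\<close>; the left inequality is what
    \<open>e2\<close> provides.\<close>
  define Y where "Y j = Min ((\<lambda>i. - e i) ` {1..j})" for j
  have Y_le: "Y j \<le> - e j" if "1 \<le> j" for j
    unfolding Y_def using that by (intro Min_le) auto
  have le_Y: "e (d + 1 - j) \<le> Y j" if "1 \<le> j" "j \<le> ?m" for j
    unfolding Y_def using that e2[of _ j] by (subst Min_ge_iff) (auto, smt (verit))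
  have Y0: "0 \<le> Y j" if "1 \<le> j" "j \<le> ?m" for j
    unfolding Y_def using that e1 by (subst Min_ge_iff) auto
  have anti: "Y (Suc j) \<le> Y j" if "1 \<le> j" for j
    unfolding Y_def using that by (intro Min_antimono) auto
  have "e j * h j + e (d + 1 - j) * h (d + 1 - j) \<le> - (Y j * (h j - h (d + 1 - j)))"
    if "j \<in> {1..?m}" for j
  proof -
    have "e j * h j \<le> (- Y j) * h j" using Y_le[of j] h[of j] that by (intro mult_right_mono) auto
    moreover have "e (d + 1 - j) * h (d + 1 - j) \<le> Y j * h (d + 1 - j)"
      using le_Y[of j] h[of "d + 1 - j"] that by (intro mult_right_mono) auto
    ultimately show ?thesis by (simp add: algebra_simps)
  qed
  then have "(\<Sum>j=1..?m. e j * h j + e (d + 1 - j) * h (d + 1 - j)) \<le>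
      (\<Sum>j=1..?m. - (Y j * (h j - h (d + 1 - j))))" by (rule sum_mono)
  moreover have "0 \<le> (\<Sum>j=1..?m. Y j * (h j - h (d + 1 - j)))"
  proof (cases "1 \<le> ?m")
    case True
    have "0 \<le> Y ?m * (\<Sum>j=1..?m. h j - h (d + 1 - j))"
      using Y0[of ?m] hibi[of ?m] True by (intro mult_nonneg_nonneg) auto
    also have "\<dots> \<le> (\<Sum>j=1..?m. Y j * (h j - h (d + 1 - j)))"
      using anti hibi True by (intro abel_lower_bound) auto
    finally show ?thesis .
  qed auto
  moreover have "e 0 * h 0 \<le> 0" using e1[of 0] h[of 0] by (intro mult_nonpos_nonneg) auto
  moreover have "e ((d + 1) div 2) * h ((d + 1) div 2) \<le> 0" if "odd d"
    using e1[of "(d + 1) div 2"] h[of "(d + 1) div 2"] that by (intro mult_nonpos_nonneg) (auto elim!: oddE)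
  ultimately show ?thesis
    unfolding half_sum_split[of "\<lambda>k. e k * h k" d] by (auto simp: sum_negf)
qed

text \<open>
  The increment \<open>D i\<close> of \<open>f\<^sup>*\<close> from \<open>i\<close> to \<open>i + 1\<close> is the linear form in \<open>h\<close> with coefficients
  \<open>increment d k i\<close>. It is non-negative in the first half. From there on, with \<open>(\<alpha>, \<beta>) = ratio d i\<close>,
  the inequality \<open>\<beta> * D (i + 1) \<le> \<alpha> * D i\<close> prevents an ascent after a descent. The ratios
  were found by solving the linear program; for \<open>d = 13\<close> the first two are forced, and for \<open>d = 14\<close> none works.
\<close>

definition increment :: "nat \<Rightarrow> nat \<Rightarrow> nat \<Rightarrow> int" where
  "increment d k j = int ((d + 1 - k) choose (d - Suc j)) - int ((d + 1 - k) choose (d - j))"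

text \<open>For pairs outside the table the default \<open>(0, 1)\<close> asks for
  \<open>D (i + 1) \<le> 0\<close> unconditionally.\<close>

definition ratio :: "nat \<Rightarrow> nat \<Rightarrow> int \<times> int" where
  "ratio d i = (case map_of
     [((7, 3), (1, 1)), ((8, 4), (1, 1)), ((9, 4), (2, 1)), ((10, 5), (1, 1)), ((11, 5), (2, 1)),
      ((11, 6), (2, 3)), ((12, 6), (4, 3)), ((12, 7), (1, 2)), ((13, 6), (7, 3)), ((13, 7), (1, 1))] (d, i)
   of None \<Rightarrow> (0, 1) | Some x \<Rightarrow> x)"

definition combined :: "nat \<Rightarrow> nat \<Rightarrow> nat \<Rightarrow> int" where
  "combined d i k = snd (ratio d i) * increment d k (Suc i) - fst (ratio d i) * increment d k i"

text \<open>These are the hypotheses \<open>e1\<close> and \<open>e2\<close> of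
  \<open>linear_form_nonpos\<close>, for coefficients stored in a list.\<close>

definition nonpos_row :: "nat \<Rightarrow> int list \<Rightarrow> bool" where
  "nonpos_row d v \<longleftrightarrow> (\<forall>j\<in>{..(d + 1) div 2}. v ! j \<le> 0) \<and>
    (\<forall>j\<in>{..d div 2}. \<forall>r\<in>{..d div 2}. 1 \<le> j \<and> j \<le> r \<longrightarrow> v ! j + v ! (d + 1 - r) \<le> 0)"

definition certificate :: "nat \<Rightarrow> bool" where
  "certificate d \<longleftrightarrow>
    (\<forall>i\<in>{..<d div 2}. \<forall>k\<in>{..d}. 0 \<le> increment d k i) \<and>
    (\<forall>i\<in>{..<d - 1}. d div 2 \<le> i \<longrightarrow> 0 \<le> fst (ratio d i) \<and> 0 < snd (ratio d i) \<and>
      nonpos_row d (map (combined d i) [0..<d + 1]))"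

lemma binomial_eq_div:
  "n choose k = (if k \<le> n then fact n div (fact k * fact (n - k)) else 0)" for n k :: nat
  by (auto simp: binomial_fact' binomial_eq_0)

text \<open>The definitions are unfolded in stages: each entry is evaluated once, after the bounded
  quantifiers over it have been expanded.\<close>

lemma certificate_upto_13:
  "\<forall>d\<in>{1, 2, 3, 4, 5, 6, 7, 8, 9, 10, 11, 12, 13}. certificate d"
  apply (simp add: certificate_def lessThan_nat_numeral atMost_nat_numeral lessThan_Suc atMost_Suc del: upt_Suc)
  apply (simp add: upt_conv_Cons combined_def increment_def ratio_def binomial_eq_div fact_numeral)
  apply (simp add: nonpos_row_def atMost_nat_numeral atMost_Suc)
  done

section \<open>Unimodality\<close>

lemma unimodalI_no_valley:
  assumes "a \<noteq> []"
    and "\<And>i j. i < j \<Longrightarrow> Suc j < length a \<Longrightarrow> a ! Suc i < a ! i \<Longrightarrow> a ! Suc j \<le> a ! j"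
  shows "unimodal a"
proof -
  let ?Q = "\<lambda>i. length a \<le> Suc i \<or> a ! Suc i < a ! i"
  \<comment> \<open>The first descent, or the last index if there is none.\<close>
  define p where "p = (LEAST i. ?Q i)"
  have Q: "?Q (length a - 1)" using assms(1) by (cases a) auto
  have p: "?Q p" unfolding p_def by (rule LeastI[of ?Q, OF Q])
  have "p \<le> length a - 1" unfolding p_def by (rule Least_le[of ?Q, OF Q])
  then have "p < length a" using assms(1) by (cases a) auto
  moreover have "a ! i \<le> a ! Suc i" if "i < p" for i
    using not_less_Least[of i ?Q] that unfolding p_def by auto
  moreover have "a ! Suc i \<le> a ! i" if "p \<le> i" "Suc i < length a" for i
    using p assms(2)[of p i] that by (cases "i = p") auto
  ultimately show ?thesis unfolding unimodal_def by blast
qed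

definition fstar_of_hstar :: "nat \<Rightarrow> (nat \<Rightarrow> real) \<Rightarrow> real list" where
  "fstar_of_hstar d h = map (\<lambda>j. \<Sum>k\<le>d. h k * real ((d + 1 - k) choose (d - j))) [0..<d + 1]"

text \<open>Vandermonde's identity for \<open>n + d - k = (n - 1) + (d + 1 - k)\<close> rewrites
  each binomial in the basis defining the \<open>f\<^sup>*\<close>-vector.\<close>

lemma is_fstar_vector_hstar:
  fixes P :: "(real ^ 'n) set" and h :: "nat \<Rightarrow> real"
  assumes "\<And>n. 0 < n \<Longrightarrow> real (ehr P n) = (\<Sum>k\<le>CARD('n). h k * real ((n + CARD('n) - k) choose CARD('n)))"
  shows "is_fstar_vector P (fstar_of_hstar CARD('n) h)"
proof -
  let ?d = "CARD('n)"
  have "real (ehr P n) = (\<Sum>j\<le>?d. fstar_of_hstar ?d h ! j * real ((n - 1) choose j))" if n: "0 < n" for n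
  proof -
    have V: "(\<Sum>j\<le>?d. ((n - 1) choose j) * ((?d + 1 - k) choose (?d - j))) = (n + ?d - k) choose ?d"
      if "k \<le> ?d" for k
    proof -
      have "n - 1 + (?d + 1 - k) = n + ?d - k" using n that by auto
      then show ?thesis using vandermonde[of "n - 1" "?d + 1 - k" ?d] by simp
    qed
    have "real (ehr P n) = (\<Sum>k\<le>?d. h k * real (\<Sum>j\<le>?d. ((n - 1) choose j) * ((?d + 1 - k) choose (?d - j))))"
      unfolding assms[OF n] by (intro sum.cong refl) (use V in auto)
    also have "\<dots> = (\<Sum>k\<le>?d. \<Sum>j\<le>?d. h k * real ((?d + 1 - k) choose (?d - j)) * real ((n - 1) choose j))"
      by (simp add: sum_distrib_left mult.assoc mult.commute mult.left_commute)
    also have "\<dots> = (\<Sum>j\<le>?d. \<Sum>k\<le>?d. h k * real ((?d + 1 - k) choose (?d - j)) * real ((n - 1) choose j))"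
      by (rule sum.swap)
    also have "\<dots> = (\<Sum>j\<le>?d. fstar_of_hstar ?d h ! j * real ((n - 1) choose j))"
    proof (intro sum.cong refl)
      fix j assume "j \<in> {..?d}"
      then have "fstar_of_hstar ?d h ! j = (\<Sum>k\<le>?d. h k * real ((?d + 1 - k) choose (?d - j)))"
        unfolding fstar_of_hstar_def by (subst nth_map) (auto simp del: upt_Suc)
      then show "(\<Sum>k\<le>?d. h k * real ((?d + 1 - k) choose (?d - j)) * real ((n - 1) choose j)) =
          fstar_of_hstar ?d h ! j * real ((n - 1) choose j)"
        by (simp add: sum_distrib_right)
    qed
    finally show ?thesis .
  qed
  then show ?thesis by (simp add: is_fstar_vector_def fstar_of_hstar_def)
qed

text \<open>The first half has no descent. Beyond it a non-positive increment forces the next one to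
  be non-positive, so no ascent can follow a descent.\<close>

lemma unimodal_fstar_of_hstar:
  fixes h :: "nat \<Rightarrow> real"
  assumes d: "1 \<le> d" "d \<le> 13"
    and h: "\<And>k. 0 \<le> h k"
    and hibi: "\<And>r. 1 \<le> r \<Longrightarrow> r \<le> d div 2 \<Longrightarrow> 0 \<le> (\<Sum>j=1..r. h j - h (d + 1 - j))"
  shows "unimodal (fstar_of_hstar d h)"
proof (rule unimodalI_no_valley)
  let ?a = "fstar_of_hstar d h"
  define D where "D i = (\<Sum>k\<le>d. of_int (increment d k i) * h k)" for i
  have len: "length ?a = d + 1" by (simp add: fstar_of_hstar_def)
  have nth: "?a ! j = (\<Sum>k\<le>d. h k * real ((d + 1 - k) choose (d - j)))" if "j \<le> d" for j
    unfolding fstar_of_hstar_def using that by (subst nth_map) (auto simp del: upt_Suc)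
  have D: "D i = ?a ! Suc i - ?a ! i" if "i < d" for i
    using that by (simp add: D_def nth increment_def algebra_simps flip: sum_subtractf)
  have "d = 1 \<or> d = 2 \<or> d = 3 \<or> d = 4 \<or> d = 5 \<or> d = 6 \<or> d = 7 \<or> d = 8 \<or> d = 9 \<or> d = 10 \<or>
      d = 11 \<or> d = 12 \<or> d = 13" using d by presburger
  then have "certificate d" using certificate_upto_13 by auto
  then have inc: "\<And>i k. i < d div 2 \<Longrightarrow> k \<le> d \<Longrightarrow> 0 \<le> increment d k i"
    and rat: "\<And>i. d div 2 \<le> i \<Longrightarrow> i < d - 1 \<Longrightarrow> 0 \<le> fst (ratio d i)"
      "\<And>i. d div 2 \<le> i \<Longrightarrow> i < d - 1 \<Longrightarrow> 0 < snd (ratio d i)"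
    and row: "\<And>i. d div 2 \<le> i \<Longrightarrow> i < d - 1 \<Longrightarrow> nonpos_row d (map (combined d i) [0..<d + 1])"
    unfolding certificate_def by auto
  have low: "0 \<le> D i" if "i < d div 2" for i
    unfolding D_def using inc[OF that] h by (intro sum_nonneg mult_nonneg_nonneg) auto
  have descend: "D (Suc i) \<le> 0" if i: "d div 2 \<le> i" "i < d - 1" and neg: "D i \<le> 0" for i
  proof -
    have nthm: "map (combined d i) [0..<d + 1] ! k = combined d i k" if "k \<le> d" for k
      using that by (subst nth_map) (auto simp del: upt_Suc)
    have "(\<Sum>k\<le>d. of_int (combined d i k) * h k) \<le> 0"
    proof (rule linear_form_nonpos)
      show "real_of_int (combined d i j) \<le> 0" if "j \<le> (d + 1) div 2" for j
      proof -
        have "j \<le> d" using that d by linarith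
        then show ?thesis using row[OF i] that nthm[of j] unfolding nonpos_row_def by (metis atMost_iff of_int_le_0_iff)
      qed
      show "real_of_int (combined d i j) + real_of_int (combined d i (d + 1 - r)) \<le> 0"
        if "1 \<le> j" "j \<le> r" "r \<le> d div 2" for j r
      proof -
        have "j \<le> d" "d + 1 - r \<le> d" "j \<le> d div 2" using that d by linarith+
        then have "combined d i j + combined d i (d + 1 - r) \<le> 0"
          using row[OF i] that nthm unfolding nonpos_row_def by (metis atMost_iff)
        then show ?thesis by linarith
      qed
    qed (use h hibi in auto)
    also have "(\<Sum>k\<le>d. of_int (combined d i k) * h k) =
        of_int (snd (ratio d i)) * D (Suc i) - of_int (fst (ratio d i)) * D i"
      by (simp add: combined_def D_def sum_distrib_left algebra_simps flip: sum_subtractf)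
    finally have "of_int (snd (ratio d i)) * D (Suc i) \<le> of_int (fst (ratio d i)) * D i" by simp
    also have "\<dots> \<le> 0" using rat(1)[OF i] neg by (intro mult_nonneg_nonpos) auto
    finally show ?thesis using rat(2)[OF i] by (simp add: mult_le_0_iff)
  qed
  show "?a ! Suc j \<le> ?a ! j" if ij: "i < j" "Suc j < length ?a" "?a ! Suc i < ?a ! i" for i j
  proof -
    have "D i < 0" using D[of i] ij len by simp
    then have i: "d div 2 \<le> i" using low[of i] by fastforce
    have "D k \<le> 0" if "i \<le> k" "k < d" for k
      using that
    proof (induction k rule: dec_induct)
      case base
      show ?case using \<open>D i < 0\<close> by simp
    next
      case (step k)
      then have "D k \<le> 0" by simp
      with \<open>d div 2 \<le> i\<close> step.hyps step.prems show ?case by (intro descend) auto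
    qed
    then have "D j \<le> 0" using ij len by simp
    then show ?thesis using D[of j] ij(2) len by simp
  qed
qed (simp add: fstar_of_hstar_def)

section \<open>Partial sums of the differences of \<open>h\<close> as boundary coefficients\<close>

lemma abel_summation:
  fixes g F :: "nat \<Rightarrow> int"
  shows "(\<Sum>k\<le>m. g k * F k) = (\<Sum>j\<le>m. g j) * F m + (\<Sum>k<m. (\<Sum>j\<le>k. g j) * (F k - F (Suc k)))"
  by (induction m) (simp_all add: algebra_simps)

text \<open>Triangular elimination: at \<open>n = k\<close> the terms beyond \<open>k\<close> vanish
  and the earlier ones are zero by induction. The value \<open>b 0\<close> is out of reach because
  \<open>n = 0\<close> is excluded, so it is a hypothesis.\<close>

lemma binomial_combination_zero:
  fixes b :: "nat \<Rightarrow> int"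
  assumes d: "1 \<le> d" and b0: "b 0 = 0"
    and zero: "\<And>n. 0 < n \<Longrightarrow> (\<Sum>k\<le>d. b k * int ((n + d - 1 - k) choose (d - 1))) = 0"
  shows "k \<le> d \<Longrightarrow> b k = 0"
proof (induction k rule: less_induct)
  case (less k)
  show ?case
  proof (cases "k = 0")
    case False
    have "b i * int ((k + d - 1 - i) choose (d - 1)) = (if i = k then b k else 0)" if "i \<le> d" for i
    proof (cases i k rule: linorder_cases)
      case greater
      then have "(k + d - 1 - i) choose (d - 1) = 0" using that False d by (intro binomial_eq_0) linarith
      then show ?thesis using greater by simp
    next
      case equal
      then show ?thesis using d by simp
    qed (use less that in auto)
    then have "(\<Sum>i\<le>d. b i * int ((k + d - 1 - i) choose (d - 1))) = (\<Sum>i\<le>d. if i = k then b k else 0)"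
      by (intro sum.cong) auto
    then show ?thesis using zero[of k] False less.prems by simp
  qed (simp add: b0)
qed

lemma ehr_eq_card:
  assumes "0 < n"
  shows "ehr P n = card {z \<in> integer_points. (1 / real n) *\<^sub>R z \<in> P}"
proof -
  have "(\<lambda>x. real n *\<^sub>R x) ` P \<inter> integer_points = {z \<in> integer_points. (1 / real n) *\<^sub>R z \<in> P}"
    using assms by (auto intro!: image_eqI[of _ _ "(1 / real n) *\<^sub>R _"])
  then show ?thesis by (simp add: ehr_def)
qed

lemma (in full_polytope) finite_dilated_points: "finite {z \<in> integer_points. (1 / real n) *\<^sub>R z \<in> P}" if n: "0 < n"
proof -
  have "bounded P" using fin by (simp add: finite_imp_bounded_convex_hull)
  then obtain M where M: "\<And>x. x \<in> P \<Longrightarrow> norm x \<le> M" by (auto simp: bounded_iff)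
  have "\<bar>z $ i\<bar> \<le> real n * M" if "(1 / real n) *\<^sub>R z \<in> P" for z i
  proof -
    have "\<bar>z $ i\<bar> \<le> norm z" by (rule component_le_norm_cart)
    also have "norm z = real n * norm ((1 / real n) *\<^sub>R z)" using n by simp
    also have "\<dots> \<le> real n * M" using M[OF that] by (intro mult_left_mono) auto
    finally show ?thesis .
  qed
  then show ?thesis
    by (intro finite_subset[OF _ finite_integer_points_bounded[of "real n * M"]]) auto
qed

lemma (in full_polytope) hstar_vector:
  "\<exists>h :: nat \<Rightarrow> nat. (\<forall>n>0. ehr P n = (\<Sum>k\<le>CARD('n). h k * ((n + CARD('n) - k) choose CARD('n)))) \<and>
    (\<forall>r. 1 \<le> r \<and> r \<le> CARD('n) \<longrightarrow> 0 \<le> (\<Sum>j=1..r. int (h j) - int (h (CARD('n) + 1 - j))))"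
proof -
  let ?d = "CARD('n)"
  have d: "1 \<le> ?d" by (simp add: Suc_le_eq)
  obtain h :: "nat \<Rightarrow> nat" where h: "h 0 = 1" "h (?d + 1) = 0"
    and hP: "\<And>n. 0 < n \<Longrightarrow> card {z \<in> integer_points. (1 / real n) *\<^sub>R z \<in> P} =
      (\<Sum>k\<le>?d + 1. h k * ((n + ?d - k) choose ?d))"
    and hI: "\<And>n. 0 < n \<Longrightarrow> card {z \<in> integer_points. (1 / real n) *\<^sub>R z \<in> interior P} =
      (\<Sum>k\<le>?d + 1. h (?d + 1 - k) * ((n + ?d - k) choose ?d))"
    using ehrhart_reciprocity by blast
  define g where "g k = int (h k) - int (h (?d + 1 - k))" for k
  define G where "G k = (\<Sum>j\<le>k. g j)" for k
  have G_top: "G (?d + 1) = 0"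
  proof -
    have "(\<Sum>j\<le>?d + 1. int (h (?d + 1 - j))) = (\<Sum>j\<le>?d + 1. int (h j))"
      by (rule sum.reindex_bij_witness[of _ "\<lambda>j. ?d + 1 - j" "\<lambda>j. ?d + 1 - j"]) auto
    then show ?thesis by (simp add: G_def g_def sum_subtractf)
  qed
  have bd: "int (card {z \<in> integer_points. (1 / real n) *\<^sub>R z \<in> P - interior P}) =
      (\<Sum>k\<le>?d. G k * int ((n + ?d - 1 - k) choose (?d - 1)))" if n: "0 < n" for n
  proof -
    let ?I = "{z \<in> integer_points. (1 / real n) *\<^sub>R z \<in> interior P}"
    let ?A = "{z \<in> integer_points. (1 / real n) *\<^sub>R z \<in> P}"
    have "{z \<in> integer_points. (1 / real n) *\<^sub>R z \<in> P - interior P} = ?A - ?I" by auto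
    moreover have "?I \<subseteq> ?A" using interior_subset by blast
    ultimately have "int (card {z \<in> integer_points. (1 / real n) *\<^sub>R z \<in> P - interior P}) = int (card ?A) - int (card ?I)"
      using finite_dilated_points[OF n] by (simp add: card_Diff_subset finite_subset of_nat_diff card_mono)
    also have "\<dots> = (\<Sum>k\<le>?d + 1. g k * int ((n + ?d - k) choose ?d))"
      unfolding hP[OF n] hI[OF n] g_def of_nat_sum of_nat_mult left_diff_distrib sum_subtractf ..
    \<comment> \<open>Summation by parts leaves no end term, as \<open>G (?d + 1) = 0\<close>;
      Pascal's rule then lowers the binomials from \<open>?d\<close> to
      \<open>?d - 1\<close>.\<close>
    also have "\<dots> = (\<Sum>k<?d + 1. G k * (int ((n + ?d - k) choose ?d) - int ((n + ?d - Suc k) choose ?d)))"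
      unfolding abel_summation[of g] using G_top by (simp add: G_def)
    also have "\<dots> = (\<Sum>k\<le>?d. G k * int ((n + ?d - 1 - k) choose (?d - 1)))"
    proof (intro sum.cong arg_cong2[where f = "(*)"] refl)
      fix k assume "k \<in> {..?d}"
      then obtain m where m: "n + ?d - k = Suc m" using n by (cases "n + ?d - k") auto
      obtain e where e: "?d = Suc e" using d by (cases ?d) auto
      have m': "n + ?d - Suc k = m" "n + ?d - 1 - k = m" using m by auto
      show "int ((n + ?d - k) choose ?d) - int ((n + ?d - Suc k) choose ?d) = int ((n + ?d - 1 - k) choose (?d - 1))"
        unfolding m m' by (simp add: e)
    qed auto
    finally show ?thesis .
  qed
  \<comment> \<open>\<open>boundary_count\<close> supplies a separate \<open>a\<close> for each
    \<open>k\<close>, built from its own direction; uniqueness identifies each of them with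
    \<open>G\<close>.\<close>
  have "1 \<le> G k" if k: "k \<le> ?d" for k
  proof -
    obtain a :: "nat \<Rightarrow> nat" where a: "a 0 = 1" "1 \<le> a k"
      and aB: "\<And>n. 0 < n \<Longrightarrow> card {z \<in> integer_points. (1 / real n) *\<^sub>R z \<in> P - interior P} =
        (\<Sum>i\<le>?d. a i * ((n + ?d - 1 - i) choose (?d - 1)))"
      using boundary_count[OF k] by blast
    have "G k - int (a k) = 0"
    proof (rule binomial_combination_zero[OF d _ _ k])
      show "G 0 - int (a 0) = 0" using a h by (simp add: G_def g_def)
      show "(\<Sum>i\<le>?d. (G i - int (a i)) * int ((n + ?d - 1 - i) choose (?d - 1))) = 0" if n: "0 < n" for n
        using bd[OF n] aB[OF n] by (simp add: left_diff_distrib sum_subtractf)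
    qed
    then show ?thesis using a(2) by simp
  qed
  \<comment> \<open>The leading 1 is \<open>h 0 - h (?d + 1)\<close>, so it cancels against the
    bound \<open>1 \<le> G r\<close>.\<close>
  moreover have "G r = 1 + (\<Sum>j=1..r. int (h j) - int (h (?d + 1 - j)))" for r
  proof -
    have "{..r} = insert 0 {1..r}" by auto
    then show ?thesis using h by (simp add: G_def g_def)
  qed
  ultimately have "\<forall>r. 1 \<le> r \<and> r \<le> ?d \<longrightarrow> 0 \<le> (\<Sum>j=1..r. int (h j) - int (h (?d + 1 - j)))" by fastforce
  moreover have "ehr P n = (\<Sum>k\<le>?d. h k * ((n + ?d - k) choose ?d))" if n: "0 < n" for n
    unfolding ehr_eq_card[OF n] hP[OF n] using h(2) by simp
  ultimately show ?thesis by blast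
qed

theorem unimodal_fstar_vector:
  fixes P :: "(real ^ 'n) set"
  assumes d: "CARD('n) \<le> 13" and P: "lattice_polytope P" "aff_dim P = int CARD('n)"
  shows "unimodal (fstar_vector P)"
proof -
  obtain S where S: "finite S" "S \<subseteq> integer_points" "P = convex hull S"
    using P(1) by (auto simp: lattice_polytope_def)
  have "affine hull P = UNIV" using P(2) aff_dim_eq_full[of P] by simp
  then have "interior P = rel_interior P" by (simp add: rel_interior_interior)
  moreover have "P \<noteq> {}" using P(2) by (auto simp: aff_dim_empty)
  ultimately have ne: "interior P \<noteq> {}" using S(3) by (simp add: rel_interior_eq_empty)
  let ?C = "(\<lambda>s. (s, 1 :: real)) ` S"
  \<comment> \<open>Genericity is wanted for a vector of height 1, but
    \<open>generic_point_exists\<close> needs an open set. A generic vector in the open cone over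
    the interior is taken and rescaled, which keeps its coordinates nonzero.\<close>
  have "open {v :: (real ^ 'n) \<times> real. 0 < snd v \<and> (1 / snd v) *\<^sub>R fst v \<in> interior P}" (is "open ?U")
  proof -
    have "open ({v :: (real ^ 'n) \<times> real. 0 < snd v} \<inter> (\<lambda>v. (1 / snd v) *\<^sub>R fst v) -` interior P)"
      by (intro continuous_open_preimage continuous_intros open_Collect_less open_interior) auto
    moreover have "{v :: (real ^ 'n) \<times> real. 0 < snd v} \<inter> (\<lambda>v. (1 / snd v) *\<^sub>R fst v) -` interior P = ?U"
      by auto
    ultimately show ?thesis by simp
  qed
  moreover have "?U \<noteq> {}"
  proof -
    obtain x where "x \<in> interior P" using ne by blast
    then have "(x, 1) \<in> ?U" by simp
    then show ?thesis by blast
  qed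
  ultimately obtain q where q: "q \<in> ?U" "generic_point ?C q"
    using generic_point_exists[of ?C ?U] S(1) by auto
  define c where "c = (1 / snd q) *\<^sub>R fst q"
  have "(c, 1) = (1 / snd q) *\<^sub>R q" using q(1) by (simp add: c_def prod_eq_iff)
  then have "generic_point ?C (c, 1)"
    using q by (auto simp: generic_point_def basis_def real_vector.representation_scale)
  then interpret full_polytope S c
    using S q(1) by unfold_locales (auto simp: c_def)
  obtain h :: "nat \<Rightarrow> nat" where
    h: "\<And>n. 0 < n \<Longrightarrow> ehr P n = (\<Sum>k\<le>CARD('n). h k * ((n + CARD('n) - k) choose CARD('n)))"
    and hibi: "\<And>r. 1 \<le> r \<Longrightarrow> r \<le> CARD('n) \<Longrightarrow> 0 \<le> (\<Sum>j=1..r. int (h j) - int (h (CARD('n) + 1 - j)))"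
    using hstar_vector S(3) by blast
  have "is_fstar_vector P (fstar_of_hstar CARD('n) (\<lambda>k. real (h k)))"
    by (rule is_fstar_vector_hstar) (simp add: h)
  then have "fstar_vector P = fstar_of_hstar CARD('n) (\<lambda>k. real (h k))" by (rule fstar_vector_eqI)
  moreover have "unimodal (fstar_of_hstar CARD('n) (\<lambda>k. real (h k)))"
  proof (rule unimodal_fstar_of_hstar)
    show "0 \<le> (\<Sum>j=1..r. real (h j) - real (h (CARD('n) + 1 - j)))" if "1 \<le> r" "r \<le> CARD('n) div 2" for r
    proof -
      have "0 \<le> (\<Sum>j=1..r. int (h j) - int (h (CARD('n) + 1 - j)))" using that by (intro hibi) auto
      then have "0 \<le> real_of_int (\<Sum>j=1..r. int (h j) - int (h (CARD('n) + 1 - j)))" by (simp only: of_int_0_le_iff)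
      then show ?thesis by (simp only: of_int_sum of_int_diff of_int_of_nat_eq)
    qed
  qed (use d in \<open>auto simp: Suc_le_eq\<close>)
  ultimately show ?thesis by simp
qed

section \<open>A simplex in dimension 15\<close>

lemma sum_UNIV_option:
  fixes f :: "'a::finite option \<Rightarrow> 'b::comm_monoid_add"
  shows "(\<Sum>x\<in>UNIV. f x) = f None + (\<Sum>i\<in>UNIV. f (Some i))"
  by (simp add: UNIV_option_conv sum.reindex)

lemma frac_sum_Ints:
  fixes x y :: real
  assumes "0 \<le> x" "x < 1" "0 \<le> y" "y < 1" "x + y \<in> \<int>"
  shows "x = (if y = 0 then 0 else 1 - y)"
proof -
  obtain k :: int where k: "x + y = of_int k" using assms(5) by (auto elim: Ints_cases)
  with assms have "real_of_int k < real_of_int 2" "real_of_int (-1) < real_of_int k" by linarith+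
  then have "k = 0 \<or> k = 1" unfolding of_int_less_iff by linarith
  then show ?thesis using k assms by (auto simp: add_nonneg_eq_0_iff)
qed

lemma frac_diff_Ints:
  fixes x y :: real
  assumes "0 \<le> x" "x < 1" "0 \<le> y" "y < 1" "x - y \<in> \<int>"
  shows "x = y"
proof -
  obtain k :: int where k: "x - y = of_int k" using assms(5) by (auto elim: Ints_cases)
  with assms have "real_of_int k < real_of_int 1" "real_of_int (-1) < real_of_int k" by linarith+
  then have "k = 0" unfolding of_int_less_iff by linarith
  then show ?thesis using k by simp
qed

text \<open>The coordinates other than \<open>i0\<close> split into two classes of equal size, on
  which the apex is 1 and -1. This balance puts all nonzero box points at the same height
  \<open>card A + 1\<close>.\<close>

locale reeve_simplex =
  fixes i0 :: "'n::finite" and A :: "'n set" and q :: nat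
  assumes i0: "i0 \<notin> A" and card_n: "CARD('n) = 2 * card A + 1" and q: "0 < q"
begin

definition apex :: "real ^ 'n" where
  "apex = (\<chi> i. if i = i0 then real q else if i \<in> A then 1 else - 1)"

definition pt :: "'n option \<Rightarrow> real ^ 'n" where
  "pt x = (case x of None \<Rightarrow> 0 | Some i \<Rightarrow> if i = i0 then apex else axis i 1)"

lemma comb_nth:
  "(\<Sum>x\<in>UNIV. l x *\<^sub>R pt x) $ i =
    (if i = i0 then real q * l (Some i0)
     else if i \<in> A then l (Some i) + l (Some i0) else l (Some i) - l (Some i0))"
proof -
  have "(\<Sum>x\<in>UNIV. l x *\<^sub>R pt x) $ i = (\<Sum>j\<in>UNIV. l (Some j) * pt (Some j) $ i)"
    by (simp add: sum_UNIV_option pt_def)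
  also have "\<dots> = l (Some i0) * apex $ i + (\<Sum>j\<in>UNIV - {i0}. l (Some j) * pt (Some j) $ i)"
    by (subst sum.remove[of _ i0]) (auto simp: pt_def)
  also have "(\<Sum>j\<in>UNIV - {i0}. l (Some j) * pt (Some j) $ i) =
      (\<Sum>j\<in>UNIV - {i0}. if j = i then l (Some j) else 0)"
    by (intro sum.cong) (auto simp: pt_def axis_def)
  finally show ?thesis by (simp add: apex_def)
qed

lemma sum_split: "(\<Sum>i\<in>UNIV. f i) = f i0 + (\<Sum>i\<in>A. f i) + (\<Sum>i\<in>- insert i0 A. f i)"
  for f :: "'n \<Rightarrow> real"
proof -
  have "(\<Sum>i\<in>UNIV. f i) = (\<Sum>i\<in>insert i0 A. f i) + (\<Sum>i\<in>- insert i0 A. f i)"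
    by (subst sum.union_disjoint[symmetric]) auto
  then show ?thesis using i0 by simp
qed

lemma card_rest: "card (- insert i0 A) = card A"
proof -
  have "card (insert i0 A) = card A + 1" using i0 by simp
  then show ?thesis using card_n card_Diff_subset[of "insert i0 A" UNIV] by (simp add: Compl_eq_Diff_UNIV)
qed

lemma comb_inj:
  assumes "sum l UNIV = sum l' UNIV" "(\<Sum>x\<in>UNIV. l x *\<^sub>R pt x) = (\<Sum>x\<in>UNIV. l' x *\<^sub>R pt x)"
  shows "l = l'"
proof -
  have eq: "(\<Sum>x\<in>UNIV. l x *\<^sub>R pt x) $ i = (\<Sum>x\<in>UNIV. l' x *\<^sub>R pt x) $ i" for i using assms(2) by simp
  have 0: "l (Some i0) = l' (Some i0)" using eq[of i0] q unfolding comb_nth by simp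
  have 1: "l (Some i) = l' (Some i)" for i
    using eq[of i] 0 unfolding comb_nth by (auto split: if_splits)
  have "l None = l' None" using assms(1) 1 by (simp add: sum_UNIV_option)
  then show ?thesis using 1 by (metis ext option.exhaust)
qed

lemma inj_pt: "inj pt"
proof (rule injI)
  fix x y assume "pt x = pt y"
  then have "(\<lambda>b. if b = x then 1 else 0 :: real) = (\<lambda>b. if b = y then 1 else 0)"
    by (intro comb_inj) (simp_all add: if_distrib[of "\<lambda>r. r *\<^sub>R _"] cong: if_cong)
  then show "x = y" by (metis zero_neq_one)
qed

lemma pt_integer: "pt x \<in> integer_points"
  by (auto simp: pt_def integer_points_def apex_def axis_def split: option.split)

lemma affine_independent: "\<not> affine_dependent (range pt)"
proof
  assume "affine_dependent (range pt)"
  then obtain U v where U: "sum U (range pt) = 0" "v \<in> range pt" "U v \<noteq> 0" "(\<Sum>v\<in>range pt. U v *\<^sub>R v) = 0"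
    by (auto simp: affine_dependent_explicit_finite)
  have "(\<lambda>x. U (pt x)) = (\<lambda>x. 0)"
    using U(1,4) by (intro comb_inj) (simp_all add: sum.reindex inj_pt)
  then show False using U(2,3) by (metis imageE)
qed

text \<open>The box points of the simplex; the coordinate at \<open>Some i0\<close> is \<open>r / q\<close>.\<close>

definition beta :: "nat \<Rightarrow> 'n option \<Rightarrow> real" where
  "beta r x = (let c = (if r = 0 then 0 else 1 - real r / real q) in
    case x of None \<Rightarrow> c | Some i \<Rightarrow> if i \<in> A then c else real r / real q)"

text \<open>For \<open>r > 0\<close>, \<open>card A + 1\<close> coordinates equal
  \<open>1 - r / q\<close> (those in \<open>A\<close> and \<open>None\<close>) and equally many
  equal \<open>r / q\<close>, so \<open>r\<close> cancels.\<close>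

lemma sum_beta: "sum (beta r) UNIV = (if r = 0 then 0 else real (card A + 1))"
proof -
  have "(\<Sum>i\<in>A. beta r (Some i)) = (\<Sum>i\<in>A. if r = 0 then 0 else 1 - real r / real q)"
    by (intro sum.cong) (auto simp: beta_def)
  moreover have "(\<Sum>i\<in>- insert i0 A. beta r (Some i)) = (\<Sum>i\<in>- insert i0 A. real r / real q)"
    by (intro sum.cong) (auto simp: beta_def)
  moreover have "beta r (Some i0) = real r / real q" using i0 by (simp add: beta_def)
  moreover have "beta r None = (if r = 0 then 0 else 1 - real r / real q)" by (simp add: beta_def)
  ultimately show ?thesis
    unfolding sum_UNIV_option sum_split using card_rest by (simp add: algebra_simps)
qed

lemma sum_beta_iff: "sum (beta r) UNIV = real k \<longleftrightarrow> k = (if r = 0 then 0 else card A + 1)"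
proof -
  have "sum (beta r) UNIV = real (if r = 0 then 0 else card A + 1)" by (simp add: sum_beta)
  then show ?thesis by (simp only: of_nat_eq_iff eq_commute)
qed

lemma box_points_eq: "box_points pt UNIV {} k = beta ` {r. r < q \<and> sum (beta r) UNIV = real k}"
proof (intro subset_antisym subsetI)
  fix l assume "l \<in> box_points pt UNIV {} k"
  then have l: "0 \<le> l x" "l x < 1" "sum l UNIV = real k" "(\<Sum>x\<in>UNIV. l x *\<^sub>R pt x) \<in> integer_points" for x
    by (auto simp: box_points_def weighted_points_def)
  have int: "(\<Sum>x\<in>UNIV. l x *\<^sub>R pt x) $ i \<in> \<int>" for i using l(4) by (simp add: integer_points_def)
  have "real q * l (Some i0) \<in> \<int>" using int[of i0] unfolding comb_nth by simp
  then obtain z :: int where z: "real q * l (Some i0) = of_int z" by (auto elim: Ints_cases)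
  define r where "r = nat z"
  have "0 \<le> real q * l (Some i0)" using l(1) by simp
  then have "0 \<le> z" unfolding z by simp
  then have r: "real q * l (Some i0) = real r" by (simp add: z r_def)
  then have li0: "l (Some i0) = real r / real q" using q by (simp add: field_simps)
  have "r < q"
    using l(2)[of "Some i0"] q unfolding li0 by simp
  have r0: "real r / real q = 0 \<longleftrightarrow> r = 0" using q by simp
  have lA: "l (Some i) = beta r (Some i)" if "i \<noteq> i0" for i
    using int[of i] that l(1,2)[of "Some i"] l(1,2)[of "Some i0"]
      frac_sum_Ints[of "l (Some i)" "l (Some i0)"] frac_diff_Ints[of "l (Some i)" "l (Some i0)"]
    unfolding comb_nth using q by (auto simp: beta_def li0 split: if_splits)
  have lS: "l (Some i) = beta r (Some i)" for i
    using lA[of i] i0 li0 by (cases "i = i0") (auto simp: beta_def)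
  \<comment> \<open>The coordinate at \<open>None\<close> belongs to the vertex 0 and is not seen by
    integrality of the point; the integral total determines it modulo 1.\<close>
  have "l None + real r / real q = real k - (\<Sum>i\<in>UNIV. beta r (Some i)) + real r / real q"
    using l(3) by (simp add: sum_UNIV_option lS)
  also have "(\<Sum>i\<in>UNIV. beta r (Some i)) = sum (beta r) UNIV - beta r None"
    by (simp add: sum_UNIV_option)
  also have "real k - (sum (beta r) UNIV - beta r None) + real r / real q \<in> \<int>"
    unfolding sum_beta by (auto simp: beta_def)
  finally have "l None = beta r None"
    using frac_sum_Ints[of "l None" "real r / real q"] l(1,2)[of None] l(1,2)[of "Some i0"]
    unfolding li0 r0 by (simp add: beta_def)
  then have "l = beta r" using lS by (metis ext option.exhaust)
  then show "l \<in> beta ` {r. r < q \<and> sum (beta r) UNIV = real k}" using \<open>r < q\<close> l(3) by blast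
next
  fix l assume "l \<in> beta ` {r. r < q \<and> sum (beta r) UNIV = real k}"
  then obtain r where r: "r < q" "sum (beta r) UNIV = real k" "l = beta r" by blast
  have "0 \<le> beta r x \<and> beta r x < 1" for x
    using r(1) q by (auto simp: beta_def Let_def split: option.split)
  moreover have "(\<Sum>x\<in>UNIV. beta r x *\<^sub>R pt x) $ i \<in> \<int>" for i
    unfolding comb_nth using q i0 by (auto simp: beta_def)
  ultimately show "l \<in> box_points pt UNIV {} k"
    using r(2) by (auto simp: r(3) box_points_def weighted_points_def integer_points_def less_imp_le)
qed

lemma card_box_points_pt:
  "card (box_points pt UNIV {} k) = (if k = 0 then 1 else if k = card A + 1 then q - 1 else 0)"
proof -
  have "inj beta"
  proof (rule injI)
    fix r s assume "beta r = beta s"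
    then have "beta r (Some i0) = beta s (Some i0)" by simp
    then show "r = s" using q i0 by (simp add: beta_def)
  qed
  then have "card (box_points pt UNIV {} k) = card {r. r < q \<and> sum (beta r) UNIV = real k}"
    unfolding box_points_eq using card_image[OF inj_on_subset[OF _ subset_UNIV]] by blast
  also have "{r. r < q \<and> sum (beta r) UNIV = real k} =
      (if k = 0 then {0} else if k = card A + 1 then {1..<q} else {})"
    using q unfolding sum_beta_iff by auto
  finally show ?thesis by simp
qed

lemma ehr_pt:
  assumes n: "0 < n"
  shows "ehr (convex hull range pt) n = (\<Sum>k\<le>CARD('n).
    (if k = 0 then 1 else if k = card A + 1 then q - 1 else 0) * ((n + CARD('n) - k) choose CARD('n)))"
proof -
  let ?P = "convex hull range pt" and ?f = "\<lambda>l. \<Sum>x\<in>UNIV. l x *\<^sub>R pt x"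
  have "{z \<in> integer_points. (1 / real n) *\<^sub>R z \<in> ?P} = (\<Union>B\<in>{UNIV}. (\<lambda>l. \<Sum>b\<in>B. l b *\<^sub>R pt b) ` weighted_points pt B {} n)"
    (is "?L = ?R")
  proof (intro subset_antisym subsetI)
    fix z assume z: "z \<in> ?L"
    then obtain u where u: "\<forall>x\<in>range pt. 0 \<le> u x" "sum u (range pt) = 1"
        "(\<Sum>x\<in>range pt. u x *\<^sub>R x) = (1 / real n) *\<^sub>R z"
      by (auto simp: convex_hull_finite)
    have u': "(\<Sum>x\<in>UNIV. u (pt x)) = 1" "(\<Sum>x\<in>UNIV. u (pt x) *\<^sub>R pt x) = (1 / real n) *\<^sub>R z"
      using u(2,3) by (simp_all add: sum.reindex inj_pt)
    have "z = real n *\<^sub>R (\<Sum>x\<in>UNIV. u (pt x) *\<^sub>R pt x)" using n by (simp add: u')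
    then have "z = ?f (\<lambda>x. real n * u (pt x))" by (simp add: scaleR_sum_right)
    moreover have "(\<Sum>x\<in>UNIV. real n * u (pt x)) = real n" using u'(1) by (simp flip: sum_distrib_left)
    ultimately have "(\<lambda>x. real n * u (pt x)) \<in> weighted_points pt UNIV {} n"
      using u(1) z by (auto simp: weighted_points_def)
    with \<open>z = ?f (\<lambda>x. real n * u (pt x))\<close> have "z \<in> ?f ` weighted_points pt UNIV {} n"
      by (rule image_eqI)
    then show "z \<in> ?R" by simp
  next
    fix z assume "z \<in> ?R"
    then have "z \<in> ?f ` weighted_points pt UNIV {} n" by simp
    then obtain l where l: "l \<in> weighted_points pt UNIV {} n" "z = ?f l" by (rule imageE)
    have "(1 / real n) *\<^sub>R z = (\<Sum>x\<in>UNIV. (l x / real n) *\<^sub>R pt x)" by (simp add: l(2) scaleR_sum_right)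
    also have "\<dots> \<in> ?P"
    proof (rule convex_sum)
      show "(\<Sum>x\<in>UNIV. l x / real n) = 1"
        using l n by (simp add: weighted_points_def flip: sum_divide_distrib)
    qed (use l n in \<open>auto simp: weighted_points_def intro: hull_inc\<close>)
    finally show "z \<in> ?L" using l by (auto simp: weighted_points_def)
  qed
  also have "card ?R = (\<Sum>k\<le>CARD('n) + 1. (\<Sum>B\<in>{UNIV}. card (box_points pt B {} k)) *
      ((n + (CARD('n) + 1) - 1 - k) choose (CARD('n) + 1 - 1)))"
    using n by (intro card_UN_weighted_points) (auto simp: pt_integer intro!: inj_onI comb_inj)
  \<comment> \<open>The term at \<open>CARD('n) + 1 = 2 * (card A + 1)\<close> vanishes, being
    neither at 0 nor at \<open>card A + 1\<close>.\<close>
  also have "\<dots> = (\<Sum>k\<le>CARD('n). (if k = 0 then 1 else if k = card A + 1 then q - 1 else 0) *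
      ((n + CARD('n) - k) choose CARD('n)))"
    using q card_n by (simp add: card_box_points_pt)
  finally show ?thesis by (simp only: ehr_eq_card[OF n])
qed

end

lemma non_unimodal_simplex:
  "\<exists>P :: (real ^ 15) set. lattice_polytope P \<and> 15 simplex P \<and> \<not> unimodal (fstar_vector P)"
proof -
  obtain A :: "15 set" where A: "A \<subseteq> - {0}" "card A = 7"
    using obtain_subset_with_card_n[of 7 "- {0 :: 15}"] by (auto simp: Compl_eq_Diff_UNIV)
  \<comment> \<open>With \<open>m = q - 1\<close>, the entries 7, 8, 9 are \<open>12870 + m\<close>,
    \<open>11440 + 8 * m\<close>, \<open>8008 + 28 * m\<close>. They form a valley exactly for
    \<open>172 \<le> m \<le> 204\<close>; here \<open>m = 200\<close>.\<close>
  interpret reeve_simplex "0 :: 15" A 201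
    using A by unfold_locales auto
  let ?P = "convex hull range pt" and ?h = "\<lambda>k::nat. if k = 0 then 1 else if k = 8 then 200 else 0 :: real"
  have "lattice_polytope ?P"
    unfolding lattice_polytope_def using pt_integer by (intro exI[of _ "range pt"]) auto
  moreover have "15 simplex ?P"
    unfolding simplex_def using affine_independent inj_pt
    by (intro exI[of _ "range pt"]) (simp add: card_image)
  moreover have "\<not> unimodal (fstar_vector ?P)"
  proof
    assume "unimodal (fstar_vector ?P)"
    have "is_fstar_vector ?P (fstar_of_hstar CARD(15) ?h)"
    proof (rule is_fstar_vector_hstar)
      fix n :: nat assume "0 < n"
      show "real (ehr ?P n) = (\<Sum>k\<le>CARD(15). ?h k * real ((n + CARD(15) - k) choose CARD(15)))"
        unfolding ehr_pt[OF \<open>0 < n\<close>] of_nat_sum of_nat_mult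
        by (intro sum.cong arg_cong2[where f = "(*)"]) (auto simp: A)
    qed
    then have f: "fstar_vector ?P = fstar_of_hstar 15 ?h" using fstar_vector_eqI by fastforce
    have nth: "fstar_vector ?P ! j = real (16 choose (15 - j)) + 200 * real (8 choose (15 - j))" if "j \<le> 15" for j
    proof -
      have "fstar_vector ?P ! j = (\<Sum>k\<le>15. ?h k * real ((15 + 1 - k) choose (15 - j)))"
        unfolding f fstar_of_hstar_def using that by (subst nth_map) (auto simp del: upt_Suc)
      also have "\<dots> = (\<Sum>k\<in>{0, 8}. ?h k * real ((15 + 1 - k) choose (15 - j)))"
        by (rule sum.mono_neutral_right) auto
      finally show ?thesis by simp
    qed
    have "fstar_vector ?P ! 7 = 13070" "fstar_vector ?P ! 8 = 13040" "fstar_vector ?P ! 9 = 13608"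
      by (simp_all add: nth binomial_eq_div fact_numeral)
    moreover have "length (fstar_vector ?P) = 16" by (simp add: f fstar_of_hstar_def)
    moreover obtain p where p: "\<And>i. i < p \<Longrightarrow> fstar_vector ?P ! i \<le> fstar_vector ?P ! Suc i"
      "\<And>i. p \<le> i \<Longrightarrow> Suc i < length (fstar_vector ?P) \<Longrightarrow> fstar_vector ?P ! Suc i \<le> fstar_vector ?P ! i"
      using \<open>unimodal (fstar_vector ?P)\<close> unfolding unimodal_def by blast
    ultimately show False using p(1)[of 7] p(2)[of 8] by (cases "p \<le> 8") auto
  qed
  ultimately show ?thesis by blast
qed

theorem theorem1p5:
  "(\<forall>P :: (real ^ 'n) set.
      1 \<le> CARD('n) \<and> CARD('n) \<le> 13 \<and> lattice_polytope P \<and> aff_dim P = int CARD('n)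
        \<longrightarrow> unimodal (fstar_vector P)) \<and>
   (\<exists>P :: (real ^ 15) set.
      lattice_polytope P \<and> 15 simplex P \<and> \<not> unimodal (fstar_vector P))"
  by (intro conjI allI impI non_unimodal_simplex unimodal_fstar_vector) auto

end
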